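(* Let $0<\alpha\le 1$. For every $f\in\mathcal{S}_{ex}^{\ast}$ (the class with parameter $\alpha$), the inverse logarithmic coefficients $\Gamma_1,\Gamma_2,\Gamma_3$ of $f$ satisfy \[ |\Gamma_1|\le \frac{\alpha}{2}, \] \[ |\Gamma_2|\le \begin{cases} \dfrac{\alpha}{4}, & 0<\alpha\le \dfrac23,\\[6pt] \dfrac{3\alpha^2}{8}, & \dfrac23<\alpha\le1, \end{cases} \] and \[ |\Gamma_3|\le \begin{cases} \dfrac{\alpha}{6}, & 0<\alpha\le \alpha_\star,\\[8pt] \dfrac{\alpha(7\alpha+2)}{18} \sqrt{\dfrac{2(7\alpha+2)}{29\alpha^2+42\alpha+12}}, & \alpha_\star<\alpha\le \alpha_b,\\[8pt] \dfrac{29\alpha(49\alpha^2-16)^{3/2}} {2232\sqrt{29\alpha^2-12}}, & \alpha_b<\alpha<\alpha_c,\\[8pt] \dfrac{29\alpha^3}{72}, & \alpha_c\le \alpha\le 1, \end{cases} \] where $\alpha_\star\approx 0.542712$ is the unique positive root of $686x^3+327x^2-210x-92=0$, $\alpha_b\approx 0.679103$ is the unique positive root of $1421x^3+812x^2-712x-336=0$, and $\alpha_c=\sqrt{928/1943}\approx 0.691095$. All three bounds are sharp for every $\alpha\in(0,1]$: for each such $\alpha$ and each $n\in\{1,2,3\}$ there is a function $f\in\mathcal{S}_{ex}^{\ast}$ for which equality holds in the bound for $|\Gamma_n|$.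
   Context: Let $\mathbb{D}=\{z\in\mathbb{C}:|z|<1\}$. Let $\mathcal{A}$ be the class of analytic functions $f$ in $\mathbb{D}$ of the form $f(z)=z+\sum_{n=2}^{\infty}a_nz^n$. For analytic $F,G$ in $\mathbb{D}$, $F\prec G$ ($F$ is subordinate to $G$) means that there is an analytic $\omega:\mathbb{D}\to\mathbb{D}$ with $\omega(0)=0$ and $F(z)=G(\omega(z))$ for $z\in\mathbb{D}$. For $0<\alpha\le1$, $\mathcal{S}_{ex}^{\ast}$ is the class of all $f\in\mathcal{A}$ such that $\frac{zf'(z)}{f(z)}\prec e^{\alpha z}$ in $\mathbb{D}$ (the quotient being given the value $1$ at $z=0$); such $f$ are univalent. The inverse logarithmic coefficients $\Gamma_n$ of $f$ are defined by the expansion, near $w=0$, $\log\frac{f^{-1}(w)}{w}=2\sum_{n=1}^{\infty}\Gamma_nw^n$, where $f^{-1}$ is the local inverse of $f$ at $0$ and the logarithm vanishes at $w=0$. Equivalently, $\Gamma_1=-\frac12a_2$, $\Gamma_2=-\frac12a_3+\frac34a_2^2$, $\Gamma_3=-\frac12\left(a_4-4a_2a_3+\frac{10}{3}a_2^3\right)$. *)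

theory Defs
  imports "HOL-Complex_Analysis.Complex_Analysis"
begin

abbreviation unit_disc :: "complex set" where
  "unit_disc \<equiv> ball 0 1"

definition class_A :: "(complex \<Rightarrow> complex) set" where
  "class_A = {f. f holomorphic_on unit_disc \<and>
     (\<exists>a :: nat \<Rightarrow> complex. \<forall>z\<in>unit_disc. (\<lambda>n. a (n + 2) * z ^ (n + 2)) sums (f z - z))}"

definition subordinate :: "(complex \<Rightarrow> complex) \<Rightarrow> (complex \<Rightarrow> complex) \<Rightarrow> bool" where
  "subordinate F G \<longleftrightarrow>
     F holomorphic_on unit_disc \<and> G holomorphic_on unit_disc \<and>
     (\<exists>\<omega>. \<omega> holomorphic_on unit_disc \<and> \<omega> ` unit_disc \<subseteq> unit_disc \<and> \<omega> 0 = 0 \<and>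
        (\<forall>z\<in>unit_disc. F z = G (\<omega> z)))"

(* No separate assumption that f has no zeros in the punctured disc is needed: division by
   zero gives 0, which is not a value of the exponential function. *)
definition S_ex :: "real \<Rightarrow> (complex \<Rightarrow> complex) set" where
  "S_ex \<alpha> = {f \<in> class_A.
     subordinate (\<lambda>z. if z = 0 then 1 else z * deriv f z / f z)
                 (\<lambda>z. exp (complex_of_real \<alpha> * z))}"

definition local_inverse_at_0 ::
  "(complex \<Rightarrow> complex) \<Rightarrow> (complex \<Rightarrow> complex) \<Rightarrow> bool" where
  "local_inverse_at_0 f g \<longleftrightarrow>
     g analytic_on {0} \<and> g 0 = 0 \<and>
     (\<forall>\<^sub>F w in nhds 0. f (g w) = w) \<and> (\<forall>\<^sub>F z in nhds 0. g (f z) = z)"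

(* L is the branch of log (g w / w) near 0 that vanishes at 0, where g is the local inverse
   of f.  Both are determined by f up to equality near 0, so the coefficient sequence is
   unique.  The expansion starts at n = 1; the coefficient of index 0 is set to 0. *)
definition is_inv_log_coeffs :: "(complex \<Rightarrow> complex) \<Rightarrow> (nat \<Rightarrow> complex) \<Rightarrow> bool" where
  "is_inv_log_coeffs f \<Gamma> \<longleftrightarrow>
     \<Gamma> 0 = 0 \<and>
     (\<exists>g L. local_inverse_at_0 f g \<and>
        L analytic_on {0} \<and> L 0 = 0 \<and> (\<forall>\<^sub>F w in at 0. exp (L w) = g w / w) \<and>
        L has_fps_expansion Abs_fps (\<lambda>n. 2 * \<Gamma> n))"

definition inv_log_coeff :: "(complex \<Rightarrow> complex) \<Rightarrow> nat \<Rightarrow> complex" where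
  "inv_log_coeff f = (THE \<Gamma>. is_inv_log_coeffs f \<Gamma>)"

definition is_alpha_star :: "real \<Rightarrow> bool" where
  "is_alpha_star x \<longleftrightarrow> x > 0 \<and> 686 * x ^ 3 + 327 * x ^ 2 - 210 * x - 92 = 0"

definition is_alpha_b :: "real \<Rightarrow> bool" where
  "is_alpha_b x \<longleftrightarrow> x > 0 \<and> 1421 * x ^ 3 + 812 * x ^ 2 - 712 * x - 336 = 0"

definition alpha_star :: real where
  "alpha_star = (THE x. is_alpha_star x)"

definition alpha_b :: real where
  "alpha_b = (THE x. is_alpha_b x)"

definition alpha_c :: real where
  "alpha_c = sqrt (928 / 1943)"

definition bound1 :: "real \<Rightarrow> real" where
  "bound1 \<alpha> = \<alpha> / 2"

definition bound2 :: "real \<Rightarrow> real" where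
  "bound2 \<alpha> = (if \<alpha> \<le> 2 / 3 then \<alpha> / 4 else 3 * \<alpha> ^ 2 / 8)"

definition bound3 :: "real \<Rightarrow> real" where
  "bound3 \<alpha> =
     (if \<alpha> \<le> alpha_star then \<alpha> / 6
      else if \<alpha> \<le> alpha_b then
        \<alpha> * (7 * \<alpha> + 2) / 18 * sqrt (2 * (7 * \<alpha> + 2) / (29 * \<alpha> ^ 2 + 42 * \<alpha> + 12))
      else if \<alpha> < alpha_c then
        29 * \<alpha> * (49 * \<alpha> ^ 2 - 16) powr (3 / 2) / (2232 * sqrt (29 * \<alpha> ^ 2 - 12))
      else 29 * \<alpha> ^ 3 / 72)"

end

theory Submission
  imports Defs
begin

text \<open>
  Let \<open>z f' / f = exp (\<alpha> \<omega>)\<close> with a Schwarz function \<open>\<omega>(z) = c\<^sub>1 z + c\<^sub>2 z^2 + c\<^sub>3 z^3 + \<dots>\<close>.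
  If \<open>L\<close> generates the inverse logarithmic coefficients, then \<open>L (f z) = log (z / f z)\<close>, and
  differentiating this identity of power series gives
  \<open>\<Gamma>\<^sub>1 = -\<alpha>/2 c\<^sub>1\<close>, \<open>\<Gamma>\<^sub>2 = -\<alpha>/4 (c\<^sub>2 - 3/2 \<alpha> c\<^sub>1^2)\<close> and
  \<open>\<Gamma>\<^sub>3 = -\<alpha>/6 (c\<^sub>3 - \<mu> c\<^sub>1 c\<^sub>2 + \<nu> c\<^sub>1^3)\<close> with \<open>\<mu> = 7\<alpha>/2\<close> and \<open>\<nu> = 29\<alpha>^2/12\<close>
  (\<open>inv_log_coeff_formulas\<close>).  Conversely every Schwarz function comes from some \<open>f\<close> in the class.
  So the theorem is a sharp estimate of functionals of the first three Taylor coefficients of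
  Schwarz functions.

  Those coefficients are exactly \<open>c\<^sub>2 = (1 - |c|^2) \<zeta>\<close> and
  \<open>c\<^sub>3 = (1 - |c|^2) ((1 - |\<zeta>|^2) \<eta> - cnj c \<zeta>^2)\<close> with \<open>c = c\<^sub>1\<close>, where \<open>c\<close>, \<open>\<zeta>\<close>, \<open>\<eta>\<close> range freely
  over the closed disc; this is two steps of the Schur algorithm.  The first two bounds follow
  at once.  For the third, the best \<open>\<eta>\<close> and a rotation making \<open>c\<close> nonnegative leave the
  maximisation of
  \<open>(1 - c^2) (1 - |\<zeta>|^2) + c |\<nu> c^2 - \<mu> (1 - c^2) \<zeta> - (1 - c^2) \<zeta>^2|\<close>,
  called \<open>cubic_modulus\<close>.

  For fixed \<open>|\<zeta>|\<close> the squared modulus is a concave quadratic in \<open>Re \<zeta>\<close>.  Its unconstrained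
  maximum, taken at \<open>|\<zeta>| = 1\<close>, yields the estimate \<open>phase_bound\<close>, a function of \<open>c\<close> alone
  (\<open>cubic_modulus_le_phase_bound\<close>).  Since \<open>\<mu>^2 / (4\<nu>) = 147/116\<close> does not depend on \<open>\<alpha>\<close>,
  its maximum over \<open>c\<close> is easy: it lies at \<open>c = 1\<close> for \<open>\<alpha> \<ge> \<alpha>\<^sub>c\<close>, with value \<open>\<nu>\<close>, and at an interior
  point for \<open>\<alpha>\<^sub>b < \<alpha> < \<alpha>\<^sub>c\<close>, where it is attained with a nonreal unimodular \<open>\<zeta>\<close>.  The number \<open>\<alpha>\<^sub>b\<close>
  is the parameter at which this maximiser reaches \<open>\<zeta> = 1\<close>.

  For \<open>\<alpha> \<le> \<alpha>\<^sub>b\<close> the phase bound decreases once \<open>\<zeta> = 1\<close> has ceased to be optimal, and for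
  smaller \<open>c\<close> the maximum over the phase is at a real \<open>\<zeta>\<close> or can be moved there by enlarging \<open>|\<zeta>|\<close>.  What
  remains are quadratics in \<open>|\<zeta>|\<close>, all dominated by the larger of \<open>1\<close> and the maximum of
  \<open>real_bound\<close>, the value at \<open>\<zeta> = 1\<close> (\<open>cubic_modulus_le\<close>).  These two candidates tie at
  \<open>\<alpha> = \<alpha>\<^sub>*\<close>; the first is attained by \<open>\<omega>(z) = z^3\<close>.
\<close>

section \<open>Schur parameters of Schwarz functions\<close>

text \<open>
  Boundedness by \<open>1\<close> is not strict, so that the unimodular constants, at which the Schur algorithm
  terminates, are included.
\<close>
definition schur_function :: "(complex \<Rightarrow> complex) \<Rightarrow> bool" where
  "schur_function \<phi> \<longleftrightarrow> \<phi> holomorphic_on unit_disc \<and> (\<forall>z\<in>unit_disc. cmod (\<phi> z) \<le> 1)"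

definition schwarz_function :: "(complex \<Rightarrow> complex) \<Rightarrow> bool" where
  "schwarz_function \<omega> \<longleftrightarrow>
     \<omega> holomorphic_on unit_disc \<and> \<omega> ` unit_disc \<subseteq> unit_disc \<and> \<omega> 0 = 0"

lemma Moebius_norm_identity:
  "cmod (1 + cnj a * w)^2 - cmod (a + w)^2 = (1 - cmod a^2) * (1 - cmod w^2)"
  unfolding cmod_power2 by (simp add: algebra_simps power2_eq_square)

lemma Moebius_norm_le:
  assumes "cmod a \<le> 1" "cmod w \<le> 1"
  shows "cmod (a + w) \<le> cmod (1 + cnj a * w)"
proof -
  have "0 \<le> (1 - cmod a^2) * (1 - cmod w^2)"
    using assms by (intro mult_nonneg_nonneg) (simp_all add: abs_square_le_1)
  then have "cmod (a + w)^2 \<le> cmod (1 + cnj a * w)^2"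
    unfolding Moebius_norm_identity[symmetric] by simp
  then show ?thesis
    by (rule power2_le_imp_le) simp
qed

lemma Moebius_denominator_nonzero:
  fixes a w :: complex
  assumes "cmod a \<le> 1" "cmod w < 1"
  shows "1 + cnj a * w \<noteq> 0"
proof
  assume "1 + cnj a * w = 0"
  then have "cmod (cnj a * w) = 1"
    by (metis add.commute add.inverse_unique norm_minus_cancel norm_one)
  moreover have "cmod (cnj a * w) < 1"
    using assms mult_left_le_one_le[of "cmod w" "cmod a"] by (simp add: norm_mult)
  ultimately show False by simp
qed

text \<open>
  One step of the Schur algorithm, written without a quotient so that it also covers unimodular
  constants, for which \<open>\<psi> = 0\<close> works.  Otherwise a Moebius transformation moves \<open>\<phi> 0\<close> to \<open>0\<close>, and
  the Schwarz lemma allows division by \<open>z\<close>.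
\<close>
lemma schur_step:
  assumes "schur_function \<phi>"
  obtains \<psi> where "schur_function \<psi>"
    and "\<And>z. z \<in> unit_disc \<Longrightarrow> \<phi> z * (1 + cnj (\<phi> 0) * (z * \<psi> z)) = \<phi> 0 + z * \<psi> z"
proof (cases "\<exists>z0\<in>unit_disc. cmod (\<phi> z0) = 1")
  case True
  then obtain z0 where z0: "z0 \<in> unit_disc" "cmod (\<phi> z0) = 1" by auto
  have "\<phi> constant_on unit_disc"
    by (rule maximum_modulus_principle[where U = unit_disc and \<xi> = z0])
       (use assms z0 in \<open>auto simp: schur_function_def\<close>)
  then obtain k where "\<And>z. z \<in> unit_disc \<Longrightarrow> \<phi> z = k"
    unfolding constant_on_def by blast
  then show ?thesis
    by (intro that[of "\<lambda>_. 0"]) (auto simp: schur_function_def)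
next
  case False
  define a where "a = \<phi> 0"
  have hol: "\<phi> holomorphic_on unit_disc"
    using assms by (simp add: schur_function_def)
  have lt: "cmod (\<phi> z) < 1" if "cmod z < 1" for z
    using assms False that unfolding schur_function_def by (force simp: less_le)
  have a: "cmod a < 1"
    using lt[of 0] by (simp add: a_def)
  have nz: "1 - cnj a * \<phi> z \<noteq> 0" if "cmod z < 1" for z
    using Moebius_denominator_nonzero[of "-a" "\<phi> z"] a lt[OF that] by simp
  define h where "h z = (\<phi> z - a) / (1 - cnj a * \<phi> z)" for z
  have holh: "h holomorphic_on unit_disc"
    unfolding h_def by (intro holomorphic_intros hol) (use nz in auto)
  have h0: "h 0 = 0"
    by (simp add: h_def a_def)
  have hlt: "cmod (h z) < 1" if "cmod z < 1" for z
  proof -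
    have "0 < (1 - cmod (-a)^2) * (1 - cmod (\<phi> z)^2)"
      using a lt[OF that] by (simp add: abs_square_less_1)
    then have "cmod (\<phi> z - a)^2 < cmod (1 - cnj a * \<phi> z)^2"
      unfolding Moebius_norm_identity[symmetric] by simp
    then have "cmod (\<phi> z - a) < cmod (1 - cnj a * \<phi> z)"
      by (rule power2_less_imp_less) simp
    then show ?thesis
      using nz[OF that] by (simp add: h_def norm_divide)
  qed
  obtain \<psi> where \<psi>: "\<psi> holomorphic_on unit_disc" "\<And>z. cmod z < 1 \<Longrightarrow> h z = z * \<psi> z"
      "deriv h 0 = \<psi> 0"
    using Schwarz3[OF holh h0] by metis
  have "cmod (\<psi> z) \<le> 1" if z: "cmod z < 1" for z
  proof (cases "z = 0")
    case True
    then show ?thesis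
      using Schwarz_Lemma(2)[OF holh h0 hlt, of 0] \<psi>(3) by simp
  next
    case False
    then show ?thesis
      using Schwarz_Lemma(1)[OF holh h0 hlt z] \<psi>(2)[OF z] by (simp add: norm_mult)
  qed
  then have "schur_function \<psi>"
    using \<psi>(1) by (simp add: schur_function_def)
  moreover have "\<phi> z * (1 + cnj a * (z * \<psi> z)) = a + z * \<psi> z" if "z \<in> unit_disc" for z
  proof -
    have "(\<phi> z - a) = (z * \<psi> z) * (1 - cnj a * \<phi> z)"
      using that \<psi>(2)[of z] nz[of z] by (simp add: h_def field_simps)
    then show ?thesis by (simp add: algebra_simps)
  qed
  ultimately show ?thesis
    using that unfolding a_def by blast
qed

text \<open>
  Inverting the Moebius transformation shows that the value at \<open>0\<close> and the remaining function may be
  prescribed freely.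
\<close>
lemma schur_step_converse:
  assumes "schur_function \<psi>" "cmod a \<le> 1"
  obtains \<phi> where "schur_function \<phi>"
    and "\<And>z. z \<in> unit_disc \<Longrightarrow> \<phi> z * (1 + cnj a * (z * \<psi> z)) = a + z * \<psi> z"
proof -
  have w: "cmod (z * \<psi> z) < 1" if "z \<in> unit_disc" for z
    using assms(1) that unfolding schur_function_def norm_mult
    by (metis dist_0_norm mem_ball mult_left_le norm_ge_zero order_le_less_trans)
  have nz: "1 + cnj a * (z * \<psi> z) \<noteq> 0" if "z \<in> unit_disc" for z
    using Moebius_denominator_nonzero[OF assms(2) w[OF that]] .
  define \<phi> where "\<phi> z = (a + z * \<psi> z) / (1 + cnj a * (z * \<psi> z))" for z
  have "\<phi> holomorphic_on unit_disc"
    unfolding \<phi>_def using assms(1) nz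
    by (auto intro!: holomorphic_intros simp: schur_function_def)
  moreover have "cmod (\<phi> z) \<le> 1" if "z \<in> unit_disc" for z
    using Moebius_norm_le[OF assms(2), of "z * \<psi> z"] w[OF that] nz[OF that]
    by (simp add: \<phi>_def norm_divide divide_le_eq)
  ultimately show ?thesis
    using nz by (intro that[of \<phi>]) (auto simp: schur_function_def \<phi>_def)
qed

lemma fps_expansion_eq_of_eventually_eq:
  fixes F G :: "complex fps"
  assumes "f has_fps_expansion F" "g has_fps_expansion G" "\<forall>\<^sub>F z in nhds 0. f z = g z"
  shows "F = G"
proof -
  have "g has_fps_expansion F"
    using has_fps_expansion_cong[OF assms(3) refl] assms(1) by blast
  then show ?thesis
    using assms(2) by (rule fps_expansion_unique_complex)
qed

lemma schur_fps: "schur_function \<phi> \<Longrightarrow> \<phi> has_fps_expansion fps_expansion \<phi> 0"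
  by (rule has_fps_expansion_fps_expansion[of unit_disc]) (auto simp: schur_function_def)

text \<open>
  Comparing coefficients in the multiplied-out relation of a Schur step expresses the Taylor
  coefficients of \<open>\<phi>\<close> through those of \<open>\<psi>\<close> of lower index.
\<close>
lemma schur_step_coeffs:
  fixes P Q :: "nat \<Rightarrow> complex"
  assumes "schur_function \<phi>" "schur_function \<psi>"
    and eq: "\<And>z. z \<in> unit_disc \<Longrightarrow> \<phi> z * (1 + cnj a * (z * \<psi> z)) = a + z * \<psi> z"
  defines "P \<equiv> fps_nth (fps_expansion \<phi> 0)" and "Q \<equiv> fps_nth (fps_expansion \<psi> 0)"
  shows "P 0 = a" "P 1 = of_real (1 - (cmod a)^2) * Q 0"
    and "P 2 = of_real (1 - (cmod a)^2) * (Q 1 - cnj a * (Q 0)^2)"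
proof -
  let ?F = "fps_expansion \<phi> 0" and ?G = "fps_expansion \<psi> 0"
  have "(\<lambda>z. \<phi> z * (1 + cnj a * (z * \<psi> z))) has_fps_expansion
      ?F * (1 + fps_const (cnj a) * (fps_X * ?G))"
    by (intro fps_expansion_intros schur_fps assms)
  moreover have "(\<lambda>z. a + z * \<psi> z) has_fps_expansion fps_const a + fps_X * ?G"
    by (intro fps_expansion_intros schur_fps assms)
  moreover have "eventually (\<lambda>z. \<phi> z * (1 + cnj a * (z * \<psi> z)) = a + z * \<psi> z) (nhds 0)"
    using eq by (intro eventually_mono[OF eventually_nhds_in_open[of unit_disc 0]]) auto
  ultimately have E: "?F * (1 + fps_const (cnj a) * (fps_X * ?G)) = fps_const a + fps_X * ?G"
    by (rule fps_expansion_eq_of_eventually_eq)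
  have coeff: "fps_nth (?F * (1 + fps_const (cnj a) * (fps_X * ?G))) n =
      fps_nth (fps_const a + fps_X * ?G) n" for n
    using E by simp
  have sq: "complex_of_real (1 - (cmod a)^2) = 1 - a * cnj a"
    using complex_norm_square[of a] by simp
  show P0: "P 0 = a"
    using coeff[of 0] by (simp add: P_def)
  have c1: "P 1 + P 0 * cnj a * Q 0 = Q 0"
    using coeff[of 1] by (simp add: P_def Q_def fps_mult_nth algebra_simps)
  then show P1: "P 1 = of_real (1 - (cmod a)^2) * Q 0"
    unfolding sq P0 by (simp add: algebra_simps)
  have "P 2 + P 1 * cnj a * Q 0 + P 0 * cnj a * Q 1 = Q 1"
    using coeff[of 2] by (simp add: P_def Q_def fps_mult_nth algebra_simps numeral_2_eq_2)
  then have "P 2 = Q 1 - a * cnj a * Q 1 - P 1 * cnj a * Q 0"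
    unfolding P0 by (simp add: algebra_simps)
  then show "P 2 = of_real (1 - (cmod a)^2) * (Q 1 - cnj a * (Q 0)^2)"
    unfolding P1 sq by (simp add: algebra_simps power2_eq_square)
qed

lemma schur_fps_nth_0: "schur_function \<phi> \<Longrightarrow> fps_nth (fps_expansion \<phi> 0) 0 = \<phi> 0"
  by (simp add: fps_expansion_def)

lemma schwarz_schur_coeffs:
  assumes "schur_function \<phi>" "\<omega> holomorphic_on unit_disc"
    and "\<And>z. z \<in> unit_disc \<Longrightarrow> \<omega> z = z * \<phi> z"
  shows "fps_nth (fps_expansion \<omega> 0) (Suc n) = fps_nth (fps_expansion \<phi> 0) n"
proof -
  have "(\<lambda>z. z * \<phi> z) has_fps_expansion fps_X * fps_expansion \<phi> 0"
    by (intro fps_expansion_intros schur_fps assms)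
  moreover have "eventually (\<lambda>z. \<omega> z = z * \<phi> z) (nhds 0)"
    using assms by (intro eventually_mono[OF eventually_nhds_in_open[of unit_disc 0]]) auto
  moreover have "\<omega> has_fps_expansion fps_expansion \<omega> 0"
    by (rule has_fps_expansion_fps_expansion[OF _ _ assms(2)]) auto
  ultimately have "fps_expansion \<omega> 0 = fps_X * fps_expansion \<phi> 0"
    using fps_expansion_eq_of_eventually_eq by blast
  then show ?thesis by simp
qed

text \<open>
  Two Schur steps applied to \<open>\<omega>(z) / z\<close>.  Here \<open>\<zeta>\<close> and \<open>\<eta>\<close> are the second and third Schur
  parameters.
\<close>
lemma schwarz_coeffs_necessary:
  fixes C :: "nat \<Rightarrow> complex"
  assumes "schwarz_function \<omega>"
  defines "C \<equiv> fps_nth (fps_expansion \<omega> 0)"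
  obtains \<zeta> \<eta> where "cmod (C 1) \<le> 1" "cmod \<zeta> \<le> 1" "cmod \<eta> \<le> 1"
    and "C 2 = of_real (1 - (cmod (C 1))^2) * \<zeta>"
    and "C 3 = of_real (1 - (cmod (C 1))^2) * (of_real (1 - (cmod \<zeta>)^2) * \<eta> - cnj (C 1) * \<zeta>^2)"
proof -
  have hol: "\<omega> holomorphic_on unit_disc" and \<omega>0: "\<omega> 0 = 0"
    and lt: "\<And>z. cmod z < 1 \<Longrightarrow> cmod (\<omega> z) < 1"
    using assms by (force simp: schwarz_function_def)+
  obtain \<phi> where \<phi>: "\<phi> holomorphic_on unit_disc" "\<And>z. cmod z < 1 \<Longrightarrow> \<omega> z = z * \<phi> z"
      "deriv \<omega> 0 = \<phi> 0"
    using Schwarz3[OF hol \<omega>0] by metis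
  have "cmod (\<phi> z) \<le> 1" if z: "cmod z < 1" for z
  proof (cases "z = 0")
    case True
    then show ?thesis
      using Schwarz_Lemma(2)[OF hol \<omega>0 lt, of 0] \<phi>(3) by simp
  next
    case False
    then show ?thesis
      using Schwarz_Lemma(1)[OF hol \<omega>0 lt z] \<phi>(2)[OF z] by (simp add: norm_mult)
  qed
  then have s0: "schur_function \<phi>"
    using \<phi>(1) by (simp add: schur_function_def)
  obtain \<psi> where \<psi>: "schur_function \<psi>"
    "\<And>z. z \<in> unit_disc \<Longrightarrow> \<phi> z * (1 + cnj (\<phi> 0) * (z * \<psi> z)) = \<phi> 0 + z * \<psi> z"
    using schur_step[OF s0] by blast
  obtain \<tau> where \<tau>: "schur_function \<tau>"
    "\<And>z. z \<in> unit_disc \<Longrightarrow> \<psi> z * (1 + cnj (\<psi> 0) * (z * \<tau> z)) = \<psi> 0 + z * \<tau> z"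
    using schur_step[OF \<psi>(1)] by blast
  have C: "C (Suc n) = fps_nth (fps_expansion \<phi> 0) n" for n
    unfolding C_def by (rule schwarz_schur_coeffs[OF s0 hol]) (simp add: \<phi>)
  note P = schur_step_coeffs[OF s0 \<psi>] and Q = schur_step_coeffs[OF \<psi>(1) \<tau>]
  have "C 1 = \<phi> 0" "C 2 = of_real (1 - (cmod (\<phi> 0))^2) * \<psi> 0"
    "C 3 = of_real (1 - (cmod (\<phi> 0))^2) * (of_real (1 - (cmod (\<psi> 0))^2) * \<tau> 0 - cnj (\<phi> 0) * (\<psi> 0)^2)"
    using C[of 0] C[of 1] C[of 2] P Q schur_fps_nth_0[OF \<tau>(1)]
    by (simp_all add: eval_nat_numeral)
  moreover have "cmod (\<phi> 0) \<le> 1" "cmod (\<psi> 0) \<le> 1" "cmod (\<tau> 0) \<le> 1"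
    using s0 \<psi>(1) \<tau>(1) by (auto simp: schur_function_def)
  ultimately show ?thesis
    using that by metis
qed

text \<open>
  Running the Schur algorithm backwards from the constant \<open>\<eta>\<close>: the parametrisation is onto, which is
  the source of all extremal functions below.
\<close>
lemma schwarz_coeffs_sufficient:
  assumes "cmod c \<le> 1" "cmod \<zeta> \<le> 1" "cmod \<eta> \<le> 1"
  obtains \<omega> where "schwarz_function \<omega>" "fps_nth (fps_expansion \<omega> 0) 1 = c"
    and "fps_nth (fps_expansion \<omega> 0) 2 = of_real (1 - (cmod c)^2) * \<zeta>"
    and "fps_nth (fps_expansion \<omega> 0) 3 =
           of_real (1 - (cmod c)^2) * (of_real (1 - (cmod \<zeta>)^2) * \<eta> - cnj c * \<zeta>^2)"
proof -
  have \<tau>: "schur_function (\<lambda>_. \<eta>)"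
    using assms(3) by (simp add: schur_function_def)
  obtain \<psi> where \<psi>: "schur_function \<psi>"
    "\<And>z. z \<in> unit_disc \<Longrightarrow> \<psi> z * (1 + cnj \<zeta> * (z * \<eta>)) = \<zeta> + z * \<eta>"
    using schur_step_converse[OF \<tau> assms(2)] by blast
  obtain \<phi> where \<phi>: "schur_function \<phi>"
    "\<And>z. z \<in> unit_disc \<Longrightarrow> \<phi> z * (1 + cnj c * (z * \<psi> z)) = c + z * \<psi> z"
    using schur_step_converse[OF \<psi>(1) assms(1)] by blast
  define \<omega> where "\<omega> z = z * \<phi> z" for z
  have "cmod (\<omega> z) < 1" if "cmod z < 1" for z
    using \<phi>(1) that mult_left_le[of "cmod (\<phi> z)" "cmod z"]
    by (simp add: schur_function_def \<omega>_def norm_mult order_le_less_trans)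
  moreover have hol: "\<omega> holomorphic_on unit_disc"
    using \<phi>(1) unfolding \<omega>_def by (auto intro!: holomorphic_intros simp: schur_function_def)
  ultimately have "schwarz_function \<omega>"
    by (auto simp: schwarz_function_def \<omega>_def)
  moreover note P = schur_step_coeffs[OF \<phi>(1) \<psi>(1) \<phi>(2)] and Q = schur_step_coeffs[OF \<psi>(1) \<tau> \<psi>(2)]
  have C: "fps_nth (fps_expansion \<omega> 0) (Suc n) = fps_nth (fps_expansion \<phi> 0) n" for n
    by (rule schwarz_schur_coeffs[OF \<phi>(1) hol]) (simp add: \<omega>_def)
  ultimately show ?thesis
    using C[of 0] C[of 1] C[of 2] P Q schur_fps_nth_0[OF \<tau>(1)]
    by (intro that[of \<omega>]) (simp_all add: eval_nat_numeral)
qed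

section \<open>Inverse logarithmic coefficients through the Schwarz function\<close>

lemma class_A_iff:
  "f \<in> class_A \<longleftrightarrow> f holomorphic_on unit_disc \<and> f 0 = 0 \<and> deriv f 0 = 1"
proof (intro iffI conjI; (elim conjE)?)
  assume "f \<in> class_A"
  then show "f holomorphic_on unit_disc" by (simp add: class_A_def)
  obtain a where a: "\<And>z. z \<in> unit_disc \<Longrightarrow> (\<lambda>n. a (n + 2) * z ^ (n + 2)) sums (f z - z)"
    using \<open>f \<in> class_A\<close> unfolding class_A_def by blast
  define F where "F = Abs_fps (\<lambda>n. if n = 0 then 0 else if n = 1 then 1 else a n)"
  have "(\<lambda>n. fps_nth F n * z ^ n) sums f z" if "z \<in> unit_disc" for z
  proof -
    have "(\<lambda>n. fps_nth F (n + 2) * z ^ (n + 2)) sums (f z - z)"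
      using a[OF that] by (simp add: F_def)
    then have "(\<lambda>n. fps_nth F n * z ^ n) sums (f z - z + (\<Sum>i<2. fps_nth F i * z ^ i))"
      by (rule iffD1[OF sums_iff_shift[of "\<lambda>n. fps_nth F n * z ^ n" 2]])
    then show ?thesis by (simp add: F_def numeral_2_eq_2)
  qed
  then have "f has_fps_expansion F"
    by (intro has_fps_expansionI eventually_mono[OF eventually_nhds_in_open[of unit_disc 0]]) auto
  then have "fps_expansion f 0 = F" by (rule fps_expansion_eqI)
  then have "fps_nth (fps_expansion f 0) 0 = 0" "fps_nth (fps_expansion f 0) 1 = 1"
    by (simp_all add: F_def)
  then show "f 0 = 0" "deriv f 0 = 1" by (simp_all add: fps_expansion_def)
next
  assume f: "f holomorphic_on unit_disc" "f 0 = 0" "deriv f 0 = 1"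
  define a where "a n = (deriv ^^ n) f 0 / fact n" for n
  have "(\<lambda>n. a (n + 2) * z ^ (n + 2)) sums (f z - z)" if "z \<in> unit_disc" for z
  proof -
    have "(\<lambda>n. a n * z ^ n) sums f z"
      using holomorphic_power_series[OF f(1) that] by (simp add: a_def)
    then have "(\<lambda>n. a n * z ^ n) sums (f z - z + (\<Sum>i<2. a i * z ^ i))"
      using f by (simp add: a_def numeral_2_eq_2)
    then show ?thesis
      by (rule iffD2[OF sums_iff_shift[of "\<lambda>n. a n * z ^ n" 2]])
  qed
  then show "f \<in> class_A"
    using f(1) unfolding class_A_def by blast
qed

lemma class_A_fps:
  assumes "f \<in> class_A"
  shows "f has_fps_expansion fps_expansion f 0"
    and "fps_nth (fps_expansion f 0) 0 = 0" "fps_nth (fps_expansion f 0) 1 = 1"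
  using assms has_fps_expansion_fps_expansion[of unit_disc f]
  by (auto simp: class_A_iff fps_expansion_def)

text \<open>
  Since \<open>f' 0 = 1\<close>, \<open>f\<close> has a holomorphic local inverse \<open>g\<close> with \<open>g' 0 = 1\<close>.  Hence \<open>g w / w\<close> extends
  to \<open>0\<close> with value \<open>1\<close> and the principal logarithm of it is analytic there.
\<close>
lemma class_A_has_inv_log_coeffs:
  assumes "f \<in> class_A"
  shows "\<exists>\<Gamma>. is_inv_log_coeffs f \<Gamma>"
proof -
  have f: "f holomorphic_on unit_disc" "f 0 = 0" "deriv f 0 = 1"
    using assms by (auto simp: class_A_iff)
  obtain r where r: "r > 0" "ball 0 r \<subseteq> unit_disc" "open (f ` ball 0 r)" "inj_on f (ball 0 r)"
    using has_complex_derivative_locally_invertible[OF f(1), of 0] f(3) by auto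
  have holr: "f holomorphic_on ball 0 r"
    using f(1) r(2) by (rule holomorphic_on_subset)
  obtain g where g: "g holomorphic_on f ` ball 0 r"
    "\<And>z. z \<in> ball 0 r \<Longrightarrow> deriv f z * deriv g (f z) = 1" "\<And>z. z \<in> ball 0 r \<Longrightarrow> g (f z) = z"
    using holomorphic_has_inverse[OF holr _ r(4)] by auto
  have in0: "0 \<in> f ` ball 0 r"
    using f(2) r(1) by (metis centre_in_ball imageI)
  have g0: "g 0 = 0" "deriv g 0 = 1"
    using g(2)[of 0] g(3)[of 0] f r(1) by auto
  have "\<forall>\<^sub>F w in nhds 0. f (g w) = w"
    by (rule eventually_mono[OF eventually_nhds_in_open[OF r(3) in0]]) (auto simp: g(3))
  moreover have "\<forall>\<^sub>F z in nhds 0. g (f z) = z"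
    by (rule eventually_mono[OF eventually_nhds_in_open[of "ball 0 r"]]) (auto simp: g(3) r(1))
  ultimately have inv: "local_inverse_at_0 f g"
    using g(1) g0 r(3) in0 by (auto simp: local_inverse_at_0_def analytic_at)
  obtain s where s: "s > 0" "ball 0 s \<subseteq> f ` ball 0 r"
    using r(3) in0 open_contains_ball by blast
  obtain h where h: "h holomorphic_on ball 0 s" "\<And>w. cmod w < s \<Longrightarrow> g w = w * h w" "h 0 = 1"
    using Schwarz3[OF holomorphic_on_subset[OF g(1) s(2)] g0(1)] g0(2) by metis
  have h_an: "h analytic_on {0}"
    using h(1) s(1) by (auto simp: analytic_at intro!: exI[of _ "ball 0 s"])
  have L_an: "(\<lambda>w. Ln (h w)) analytic_on {0}"
    by (intro analytic_intros h_an) (auto simp: h(3))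
  have "isCont h 0"
    using h_an analytic_at_imp_isCont by blast
  then have "(h \<longlongrightarrow> 1) (nhds 0)"
    using tendsto_at_iff_tendsto_nhds[of h 0] h(3) by (simp add: isCont_def)
  then have "\<forall>\<^sub>F w in nhds 0. h w \<in> - {0}"
    by (rule topological_tendstoD) auto
  moreover have "\<forall>\<^sub>F w in nhds 0. w \<in> ball 0 s"
    using s(1) by (intro eventually_nhds_in_open) auto
  ultimately have "\<forall>\<^sub>F w in nhds 0. w \<noteq> 0 \<longrightarrow> exp (Ln (h w)) = g w / w"
    by eventually_elim (auto simp: h(2))
  then have expL: "\<forall>\<^sub>F w in at 0. exp (Ln (h w)) = g w / w"
    by (simp add: eventually_at_filter)
  define \<Gamma> where "\<Gamma> n = fps_nth (fps_expansion (\<lambda>w. Ln (h w)) 0) n / 2" for n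
  have "(\<lambda>w. Ln (h w)) has_fps_expansion Abs_fps (\<lambda>n. 2 * \<Gamma> n)"
    using analytic_at_imp_has_fps_expansion_0[OF L_an] by (simp add: \<Gamma>_def fps_nth_inverse)
  moreover have "\<Gamma> 0 = 0"
    by (simp add: \<Gamma>_def fps_expansion_def h(3))
  ultimately have "is_inv_log_coeffs f \<Gamma>"
    unfolding is_inv_log_coeffs_def using inv L_an expL h(3) by fastforce
  then show ?thesis by blast
qed

text \<open>
  Substituting \<open>w = f z\<close> in \<open>exp (L w) * w = g w\<close> eliminates the inverse function: it becomes
  \<open>exp (L (f z)) * f z = z\<close>.
\<close>
lemma inv_log_coeffs_exp_eq:
  assumes "f \<in> class_A" "is_inv_log_coeffs f \<Gamma>"
  defines "F \<equiv> fps_expansion f 0"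
  shows "(fps_exp 1 oo (Abs_fps (\<lambda>n. 2 * \<Gamma> n) oo F)) * F = fps_X"
proof -
  let ?\<Lambda> = "Abs_fps (\<lambda>n. 2 * \<Gamma> n)"
  note F = class_A_fps[OF assms(1), folded F_def]
  obtain g L where gL: "local_inverse_at_0 f g" "L 0 = 0" "\<forall>\<^sub>F w in at 0. exp (L w) = g w / w"
      "L has_fps_expansion ?\<Lambda>" and \<Gamma>0: "\<Gamma> 0 = 0"
    using assms(2) by (auto simp: is_inv_log_coeffs_def)
  have g: "g 0 = 0" "\<forall>\<^sub>F z in nhds 0. g (f z) = z"
    using gL(1) by (auto simp: local_inverse_at_0_def)
  have "\<forall>\<^sub>F w in nhds 0. w \<noteq> 0 \<longrightarrow> exp (L w) = g w / w"
    using gL(3) by (simp add: eventually_at_filter)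
  then have "\<forall>\<^sub>F w in nhds 0. exp (L w) * w = g w"
    by eventually_elim (auto simp: g(1))
  moreover have "filterlim f (nhds 0) (nhds 0)"
    using has_fps_expansion_imp_continuous[OF F(1), of UNIV] assms(1)
    by (simp add: class_A_iff isCont_def tendsto_at_iff_tendsto_nhds)
  ultimately have "\<forall>\<^sub>F z in nhds 0. exp (L (f z)) * f z = g (f z)"
    by (rule eventually_compose_filterlim)
  with g(2) have ev: "\<forall>\<^sub>F z in nhds 0. exp (L (f z)) * f z = z"
    by eventually_elim simp
  have "(L \<circ> f) has_fps_expansion (?\<Lambda> oo F)"
    by (rule has_fps_expansion_compose[OF gL(4) F(1,2)])
  then have "(exp \<circ> (L \<circ> f)) has_fps_expansion (fps_exp 1 oo (?\<Lambda> oo F))"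
    by (rule has_fps_expansion_compose[OF has_fps_expansion_exp1]) (simp add: \<Gamma>0)
  then have "(\<lambda>z. exp (L (f z)) * f z) has_fps_expansion (fps_exp 1 oo (?\<Lambda> oo F)) * F"
    using F(1) unfolding comp_def by (intro has_fps_expansion_mult)
  then show ?thesis
    using ev by (rule fps_expansion_eq_of_eventually_eq[OF _ has_fps_expansion_fps_X])
qed

text \<open>
  The logarithmic derivative of the previous identity, \<open>z (L \<circ> f)' = 1 - z f' / f\<close>, multiplied by \<open>f\<close>.
  It determines \<open>L \<circ> f\<close>, which gives uniqueness, and it involves \<open>f\<close> only through the quotient that
  the subordination controls.
\<close>
lemma inv_log_coeffs_deriv_eq:
  assumes "f \<in> class_A" "is_inv_log_coeffs f \<Gamma>"
  defines "F \<equiv> fps_expansion f 0"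
  shows "fps_X * fps_deriv (Abs_fps (\<lambda>n. 2 * \<Gamma> n) oo F) * F = F - fps_X * fps_deriv F"
proof -
  define M where "M = Abs_fps (\<lambda>n. 2 * \<Gamma> n) oo F"
  define E where "E = fps_exp 1 oo M"
  have EF: "E * F = fps_X"
    using inv_log_coeffs_exp_eq[OF assms(1,2)] by (simp add: E_def M_def F_def)
  have M0: "fps_nth M 0 = 0"
    using assms(2) by (simp add: M_def is_inv_log_coeffs_def)
  have "fps_deriv E = E * fps_deriv M"
    unfolding E_def by (subst fps_compose_deriv[OF M0]) simp
  then have "E * fps_deriv M * F + E * fps_deriv F = 1"
    using arg_cong[OF EF, of fps_deriv] by (simp add: algebra_simps)
  then have "(E * fps_deriv M * F + E * fps_deriv F) * fps_X = E * F"
    using EF by simp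
  then have "E * (fps_X * fps_deriv M * F) = E * (F - fps_X * fps_deriv F)"
    by (simp add: algebra_simps)
  moreover have "E \<noteq> 0"
    using EF by auto
  ultimately show ?thesis
    by (simp add: M_def)
qed

text \<open>
  The composition \<open>L \<circ> f\<close> is determined by its derivative and its value at \<open>0\<close>; composing with the
  compositional inverse of the series of \<open>f\<close> recovers \<open>L\<close>.
\<close>
lemma inv_log_coeffs_unique:
  assumes "f \<in> class_A" "is_inv_log_coeffs f \<Gamma>" "is_inv_log_coeffs f \<Gamma>'"
  shows "\<Gamma> = \<Gamma>'"
proof -
  define F where "F = fps_expansion f 0"
  note F = class_A_fps[OF assms(1), folded F_def]
  define M where "M \<Gamma> = Abs_fps (\<lambda>n. 2 * \<Gamma> n) oo F" for \<Gamma> :: "nat \<Rightarrow> complex"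
  have "F \<noteq> 0"
    using F(3) by auto
  moreover have "fps_X * fps_deriv (M \<Gamma>) * F = fps_X * fps_deriv (M \<Gamma>') * F"
    using inv_log_coeffs_deriv_eq[OF assms(1,2)] inv_log_coeffs_deriv_eq[OF assms(1,3)]
    by (simp add: M_def F_def)
  ultimately have "fps_deriv (M \<Gamma>) = fps_deriv (M \<Gamma>')"
    by simp
  moreover have "fps_nth (M \<Gamma>) 0 = fps_nth (M \<Gamma>') 0"
    using assms by (simp add: M_def is_inv_log_coeffs_def)
  ultimately have "M \<Gamma> = M \<Gamma>'"
    by (simp add: fps_deriv_eq_iff)
  then have "Abs_fps (\<lambda>n. 2 * \<Gamma> n) oo (F oo fps_inv F) = Abs_fps (\<lambda>n. 2 * \<Gamma>' n) oo (F oo fps_inv F)"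
    using F by (simp add: M_def fps_compose_assoc fps_inv_def)
  then have "Abs_fps (\<lambda>n. 2 * \<Gamma> n) = Abs_fps (\<lambda>n. 2 * \<Gamma>' n)"
    using fps_inv_right[of F] F by simp
  then have "2 * \<Gamma> n = 2 * \<Gamma>' n" for n
    by (metis fps_nth_Abs_fps)
  then show ?thesis by auto
qed

lemma is_inv_log_coeffs_inv_log_coeff:
  assumes "f \<in> class_A"
  shows "is_inv_log_coeffs f (inv_log_coeff f)"
proof -
  have "\<exists>!\<Gamma>. is_inv_log_coeffs f \<Gamma>"
    using class_A_has_inv_log_coeffs[OF assms] inv_log_coeffs_unique[OF assms] by blast
  then show ?thesis
    unfolding inv_log_coeff_def by (rule theI')
qed

text \<open>
  With \<open>P = exp (\<alpha> \<omega>)\<close> the recurrences \<open>z f' = f P\<close>, \<open>z (L \<circ> f)' = 1 - P\<close> and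
  \<open>P' = \<alpha> \<omega>' P\<close> give the low coefficients of \<open>f\<close>, \<open>L \<circ> f\<close> and \<open>P\<close>; those of \<open>L\<close> follow by expanding
  the composition.
\<close>
lemma inv_log_coeff_formulas:
  fixes w :: "nat \<Rightarrow> complex"
  assumes f: "f \<in> class_A" and \<omega>: "schwarz_function \<omega>"
    and eq: "\<And>z. z \<in> unit_disc \<Longrightarrow> z * deriv f z = f z * exp (of_real \<alpha> * \<omega> z)"
  defines "w \<equiv> fps_nth (fps_expansion \<omega> 0)"
  shows "inv_log_coeff f 1 = - (of_real \<alpha> / 2) * w 1"
    and "inv_log_coeff f 2 = - (of_real \<alpha> / 4) * (w 2 - 3 / 2 * of_real \<alpha> * (w 1)^2)"
    and "inv_log_coeff f 3 = - (of_real \<alpha> / 6) *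
           (w 3 - 7 / 2 * of_real \<alpha> * w 1 * w 2 + 29 / 12 * (of_real \<alpha>)^2 * (w 1)^3)"
proof -
  define a where "a = complex_of_real \<alpha>"
  define F W where "F = fps_expansion f 0" and "W = fps_expansion \<omega> 0"
  define P where "P = fps_exp a oo W"
  define \<Lambda> where "\<Lambda> = Abs_fps (\<lambda>n. 2 * inv_log_coeff f n)"
  define M where "M = \<Lambda> oo F"
  note F = class_A_fps[OF f, folded F_def]
  have W: "\<omega> has_fps_expansion W" and W0: "fps_nth W 0 = 0"
    using \<omega> has_fps_expansion_fps_expansion[of unit_disc \<omega>]
    by (auto simp: schwarz_function_def W_def fps_expansion_def)
  have "((\<lambda>x. exp (a * x)) \<circ> \<omega>) has_fps_expansion P"
    unfolding P_def using W W0 by (intro has_fps_expansion_compose has_fps_expansion_exp)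
  then have "(\<lambda>z. f z * exp (a * \<omega> z)) has_fps_expansion F * P"
    using F(1) unfolding comp_def by (intro has_fps_expansion_mult)
  moreover have "(\<lambda>z. z * deriv f z) has_fps_expansion fps_X * fps_deriv F"
    by (intro fps_expansion_intros F)
  moreover have "\<forall>\<^sub>F z in nhds 0. z * deriv f z = f z * exp (a * \<omega> z)"
    using eq by (intro eventually_mono[OF eventually_nhds_in_open[of unit_disc 0]]) (auto simp: a_def)
  ultimately have FP: "fps_X * fps_deriv F = F * P"
    by (metis fps_expansion_eq_of_eventually_eq)
  have "fps_X * fps_deriv M * F = F * (1 - P)"
    using inv_log_coeffs_deriv_eq[OF f is_inv_log_coeffs_inv_log_coeff[OF f]] FP
    by (simp add: M_def \<Lambda>_def F_def algebra_simps)
  moreover have "F \<noteq> 0"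
    using F(3) by auto
  ultimately have MP: "fps_X * fps_deriv M = 1 - P"
    by (metis mult.commute mult_left_cancel)
  have P': "fps_deriv P = fps_const a * P * fps_deriv W"
    unfolding P_def by (subst fps_compose_deriv[OF W0]) (simp add: fps_compose_mult_distrib[OF W0])
  have P0: "fps_nth P 0 = 1"
    by (simp add: P_def)
  have P1: "fps_nth P 1 = a * w 1"
    using arg_cong[OF P', of "\<lambda>S. fps_nth S 0"] P0
    by (simp add: w_def W_def)
  have P2: "2 * fps_nth P 2 = a * (2 * w 2 + fps_nth P 1 * w 1)"
    using arg_cong[OF P', of "\<lambda>S. fps_nth S 1"] P0
    by (simp add: w_def W_def fps_mult_nth eval_nat_numeral algebra_simps)
  have P3: "3 * fps_nth P 3 = a * (3 * w 3 + 2 * fps_nth P 1 * w 2 + fps_nth P 2 * w 1)"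
    using arg_cong[OF P', of "\<lambda>S. fps_nth S 2"] P0
    by (simp add: w_def W_def fps_mult_nth eval_nat_numeral algebra_simps)
  have F2: "fps_nth F 2 = fps_nth P 1"
    using arg_cong[OF FP, of "\<lambda>S. fps_nth S 2"] P0 F(2,3)
    by (simp add: fps_mult_nth eval_nat_numeral algebra_simps)
  have F3: "2 * fps_nth F 3 = fps_nth P 2 + fps_nth P 1 * fps_nth F 2"
    using arg_cong[OF FP, of "\<lambda>S. fps_nth S 3"] P0 F(2,3)
    by (simp add: fps_mult_nth eval_nat_numeral algebra_simps)
  have M: "of_nat n * fps_nth M n = - fps_nth P n" if "n > 0" for n
    using arg_cong[OF MP, of "\<lambda>S. fps_nth S n"] that by (cases n) auto
  have L0: "fps_nth \<Lambda> 0 = 0"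
    using is_inv_log_coeffs_inv_log_coeff[OF f] by (simp add: \<Lambda>_def is_inv_log_coeffs_def)
  have M1: "fps_nth M 1 = fps_nth \<Lambda> 1"
    using F(2,3) by (simp add: M_def fps_compose_nth L0)
  have M2: "fps_nth M 2 = fps_nth \<Lambda> 2 + fps_nth \<Lambda> 1 * fps_nth F 2"
    using F(2,3) by (simp add: M_def fps_compose_nth L0 fps_mult_nth eval_nat_numeral)
  have M3: "fps_nth M 3 = fps_nth \<Lambda> 3 + 2 * fps_nth \<Lambda> 2 * fps_nth F 2 + fps_nth \<Lambda> 1 * fps_nth F 3"
    using F(2,3) by (simp add: M_def fps_compose_nth L0 fps_mult_nth eval_nat_numeral)
  have p2: "fps_nth P 2 = a * w 2 + a^2 * (w 1)^2 / 2"
    using P2 unfolding P1 by (simp add: field_simps power2_eq_square)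
  have p3: "fps_nth P 3 = a * w 3 + a^2 * w 1 * w 2 + a^3 * (w 1)^3 / 6"
    using P3 unfolding P1 p2 by (simp add: field_simps power2_eq_square power3_eq_cube)
  have l1: "fps_nth \<Lambda> 1 = - fps_nth P 1"
    using M[of 1] M1 by simp
  have l2: "fps_nth \<Lambda> 2 = - fps_nth P 2 / 2 + (fps_nth P 1)^2"
    using M[of 2] M2 l1 F2 by (simp add: field_simps power2_eq_square)
  have f3: "fps_nth F 3 = (fps_nth P 2 + (fps_nth P 1)^2) / 2"
    using F3 F2 by (simp add: field_simps power2_eq_square)
  have m3: "fps_nth M 3 = - fps_nth P 3 / 3"
    using M[of 3] by (simp add: field_simps)
  have l3: "fps_nth \<Lambda> 3 = - fps_nth P 3 / 3 + 3/2 * fps_nth P 1 * fps_nth P 2 - 3/2 * (fps_nth P 1)^3"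
    using M3 unfolding m3 l1 l2 F2 f3 by (simp add: field_simps power2_eq_square power3_eq_cube)
  have \<Lambda>: "inv_log_coeff f n = fps_nth \<Lambda> n / 2" for n
    by (simp add: \<Lambda>_def)
  show "inv_log_coeff f 1 = - (of_real \<alpha> / 2) * w 1"
    unfolding \<Lambda> l1 P1 a_def[symmetric] by simp
  show "inv_log_coeff f 2 = - (of_real \<alpha> / 4) * (w 2 - 3 / 2 * of_real \<alpha> * (w 1)^2)"
    unfolding \<Lambda> l2 P1 p2 a_def[symmetric] by (simp add: field_simps power2_eq_square)
  show "inv_log_coeff f 3 = - (of_real \<alpha> / 6) *
           (w 3 - 7 / 2 * of_real \<alpha> * w 1 * w 2 + 29 / 12 * (of_real \<alpha>)^2 * (w 1)^3)"
    unfolding \<Lambda> l3 P1 p2 p3 a_def[symmetric] by (simp add: field_simps power2_eq_square power3_eq_cube)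
qed

text \<open>
  A zero of \<open>f\<close> away from \<open>0\<close> would make the quotient \<open>0\<close>, which the exponential function omits.
\<close>
lemma S_ex_imp_schwarz:
  assumes "f \<in> S_ex \<alpha>"
  obtains \<omega> where "schwarz_function \<omega>"
    and "\<And>z. z \<in> unit_disc \<Longrightarrow> z * deriv f z = f z * exp (of_real \<alpha> * \<omega> z)"
proof -
  have f: "f \<in> class_A"
    using assms by (simp add: S_ex_def)
  obtain \<omega> where \<omega>: "schwarz_function \<omega>"
    "\<And>z. z \<in> unit_disc \<Longrightarrow>
       (if z = 0 then 1 else z * deriv f z / f z) = exp (complex_of_real \<alpha> * \<omega> z)"
    using assms by (auto simp: S_ex_def subordinate_def schwarz_function_def)
  have "z * deriv f z = f z * exp (of_real \<alpha> * \<omega> z)" if "z \<in> unit_disc" for z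
  proof (cases "z = 0")
    case True
    then show ?thesis using f by (simp add: class_A_iff)
  next
    case False
    have "f z \<noteq> 0"
    proof
      assume "f z = 0"
      then show False using \<omega>(2)[OF that] False by simp
    qed
    then show ?thesis using \<omega>(2)[OF that] False by (simp add: field_simps)
  qed
  with \<omega>(1) show ?thesis by (rule that)
qed

text \<open>
  The equation \<open>z f' / f = exp (\<alpha> \<omega>)\<close> is solved by \<open>f z = z * exp (q z)\<close>, where \<open>q\<close> is a primitive of
  \<open>(exp (\<alpha> \<omega>) - 1) / z\<close>.
\<close>
lemma schwarz_imp_S_ex:
  assumes "schwarz_function \<omega>"
  obtains f where "f \<in> S_ex \<alpha>"
    and "\<And>z. z \<in> unit_disc \<Longrightarrow> z * deriv f z = f z * exp (of_real \<alpha> * \<omega> z)"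
proof -
  have \<omega>: "\<omega> holomorphic_on unit_disc" "\<omega> 0 = 0" "\<omega> ` unit_disc \<subseteq> unit_disc"
    using assms by (auto simp: schwarz_function_def)
  define e where "e z = exp (of_real \<alpha> * \<omega> z)" for z
  have e: "e holomorphic_on unit_disc"
    unfolding e_def by (intro holomorphic_intros \<omega>)
  obtain h where h: "h holomorphic_on unit_disc" "\<And>z. cmod z < 1 \<Longrightarrow> e z - 1 = z * h z"
  proof (rule Schwarz3[of "\<lambda>z. e z - 1" 1])
    show "(\<lambda>z. e z - 1) holomorphic_on unit_disc"
      by (intro holomorphic_intros e)
  qed (auto simp: e_def \<omega>(2))
  obtain q where q: "\<And>z. z \<in> unit_disc \<Longrightarrow> (q has_field_derivative h z) (at z within unit_disc)"
    using holomorphic_convex_primitive'[OF _ _ h(1)] by auto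
  define f where "f z = z * exp (q z - q 0)" for z
  have f': "(f has_field_derivative exp (q z - q 0) * e z) (at z)" if "z \<in> unit_disc" for z
  proof -
    have "(q has_field_derivative h z) (at z)"
      using q[OF that] at_within_open[OF that] by simp
    then have "(f has_field_derivative exp (q z - q 0) * (1 + z * h z)) (at z)"
      unfolding f_def by (auto intro!: derivative_eq_intros simp: algebra_simps)
    moreover have "1 + z * h z = e z"
      using h(2)[of z] that by (simp add: algebra_simps)
    ultimately show ?thesis by simp
  qed
  have d: "deriv f z = exp (q z - q 0) * e z" if "z \<in> unit_disc" for z
    using f'[OF that] by (rule DERIV_imp_deriv)
  have "f holomorphic_on unit_disc"
    by (rule iffD2[OF holomorphic_on_open[OF open_ball]]) (use f' in blast)
  moreover have "deriv f 0 = 1"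
    using d[of 0] by (simp add: e_def \<omega>)
  ultimately have f: "f \<in> class_A"
    by (simp add: class_A_iff f_def)
  have quot: "(if z = 0 then 1 else z * deriv f z / f z) = e z" if "z \<in> unit_disc" for z
    using d[OF that] by (auto simp: f_def e_def \<omega>)
  have "(\<lambda>z. if z = 0 then 1 else z * deriv f z / f z) holomorphic_on unit_disc"
    by (rule holomorphic_transform[OF e]) (simp add: quot)
  then have "f \<in> S_ex \<alpha>"
    using f quot \<omega>
    by (auto simp: S_ex_def subordinate_def e_def intro!: holomorphic_intros exI[of _ \<omega>])
  moreover have "z * deriv f z = f z * exp (of_real \<alpha> * \<omega> z)" if "z \<in> unit_disc" for z
    using d[OF that] by (simp add: f_def e_def)
  ultimately show ?thesis by (rule that)
qed

section \<open>A cubic coefficient functional on Schwarz functions\<close>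

text \<open>
  This is the largest modulus of \<open>c\<^sub>3 - m c\<^sub>1 c\<^sub>2 + \<nu> c\<^sub>1^3\<close> for given first two Schur parameters, \<open>c \<in> [0, 1]\<close>
  and \<open>\<zeta>\<close>, as the third one varies.
\<close>
definition cubic_modulus :: "real \<Rightarrow> real \<Rightarrow> real \<Rightarrow> complex \<Rightarrow> real" where
  "cubic_modulus m \<nu> c \<zeta> = (1 - c^2) * (1 - (cmod \<zeta>)^2) +
     c * cmod (of_real (\<nu> * c^2) - of_real (m * (1 - c^2)) * \<zeta> - of_real (1 - c^2) * \<zeta>^2)"

text \<open>
  The square of the modulus depends on \<open>\<zeta>\<close> only through \<open>|\<zeta>|\<close> and, quadratically, through \<open>Re \<zeta>\<close>:
  use \<open>\<zeta>^2 = 2 (Re \<zeta>) \<zeta> - |\<zeta>|^2\<close>.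
\<close>
lemma quadratic_norm_sq:
  fixes A m t :: real and \<zeta> :: complex
  shows "(cmod (of_real A - of_real (m * t) * \<zeta> - of_real t * \<zeta>^2))^2 =
    (A + t * (cmod \<zeta>)^2)^2 + m^2 * t * (t * (cmod \<zeta>)^2)
      - 2 * t * m * (A - t * (cmod \<zeta>)^2) * Re \<zeta> - 4 * t * A * (Re \<zeta>)^2"
proof -
  obtain X Y where \<zeta>: "\<zeta> = Complex X Y" by (cases \<zeta>)
  have "(cmod (of_real A - of_real (m * t) * \<zeta> - of_real t * \<zeta>^2))^2 =
     (A - m * t * X - t * (X^2 - Y^2))^2 + (m * t * Y + 2 * t * X * Y)^2"
    unfolding cmod_power2 by (simp add: \<zeta> power2_eq_square algebra_simps)
  also have "\<dots> = (A + t * (X^2 + Y^2))^2 + m^2 * t * (t * (X^2 + Y^2))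
      - 2 * t * m * (A - t * (X^2 + Y^2)) * X - 4 * t * A * X^2"
    by (simp add: power2_eq_square algebra_simps)
  finally show ?thesis
    by (simp add: \<zeta> cmod_power2)
qed

text \<open>
  Completing the square in \<open>X = Re \<zeta>\<close>.  The weights \<open>4 \<nu>\<close> and \<open>s = c^2\<close> clear the denominators, so
  that the degenerate case \<open>c = 0\<close> needs no separate treatment.  The right-hand side vanishes at
  the stationary phase.
\<close>
lemma interior_identity:
  fixes m \<nu> s t k C X :: real
  assumes "m^2 = 4 * \<nu> * k"
  defines "A \<equiv> \<nu> * s"
  shows "4 * \<nu> * ((A + C)^2 * (s + k * t) -
           s * ((A + C)^2 + m^2 * t * C - 2 * t * m * (A - C) * X - 4 * t * A * X^2)) =
         t * (m * (A - C) + 4 * A * X)^2"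
proof -
  have "4 * \<nu> * ((A + C)^2 * (s + k * t) -
           s * ((A + C)^2 + m^2 * t * C - 2 * t * m * (A - C) * X - 4 * t * A * X^2)) =
        (4 * \<nu> * k) * t * (A + C)^2 - 4 * A * (m^2 * t * C - 2 * t * m * (A - C) * X - 4 * t * A * X^2)"
    by (simp add: A_def algebra_simps power2_eq_square)
  also have "\<dots> = t * (m * (A - C) + 4 * A * X)^2"
    unfolding assms(1)[symmetric] by (simp add: algebra_simps power2_eq_square)
  finally show ?thesis .
qed

text \<open>
  The value obtained on \<open>|\<zeta>| = 1\<close>, with \<open>s = c^2\<close>, if the stationary phase were always available; the
  parameter \<open>k\<close> stands for \<open>m^2 / (4 \<nu>)\<close>.
\<close>
definition phase_bound :: "real \<Rightarrow> real \<Rightarrow> real \<Rightarrow> real" where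
  "phase_bound k \<nu> s = (\<nu> * s + (1 - s)) * sqrt (s + k * (1 - s))"

lemma modulus_le_phase_max:
  fixes m \<nu> k c :: real and \<zeta> :: complex
  assumes "m^2 = 4 * \<nu> * k" "0 < \<nu>" "0 \<le> c" "c \<le> 1"
  defines "t \<equiv> 1 - c^2"
  shows "c * cmod (of_real (\<nu> * c^2) - of_real (m * t) * \<zeta> - of_real t * \<zeta>^2) \<le>
         (\<nu> * c^2 + t * (cmod \<zeta>)^2) * sqrt (c^2 + k * t)"
proof -
  define N where "N = (cmod (of_real (\<nu> * c^2) - of_real (m * t) * \<zeta> - of_real t * \<zeta>^2))^2"
  define C where "C = t * (cmod \<zeta>)^2"
  have t: "0 \<le> t"
    using assms by (simp add: t_def power_le_one)
  have "4 * \<nu> * ((\<nu> * c^2 + C)^2 * (c^2 + k * t) - c^2 * N) =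
      t * (m * (\<nu> * c^2 - C) + 4 * (\<nu> * c^2) * Re \<zeta>)^2"
    unfolding N_def quadratic_norm_sq C_def[symmetric]
    by (rule interior_identity[OF assms(1)])
  also have "\<dots> \<ge> 0" using t by simp
  finally have "c^2 * N \<le> (\<nu> * c^2 + C)^2 * (c^2 + k * t)"
    using assms(2) by (simp add: zero_le_mult_iff)
  then have "sqrt (c^2 * N) \<le> sqrt ((\<nu> * c^2 + C)^2 * (c^2 + k * t))"
    by simp
  moreover have "0 \<le> \<nu> * c^2 + C"
    using assms(2) t by (simp add: C_def)
  ultimately show ?thesis
    using assms(3) by (simp add: real_sqrt_mult N_def C_def)
qed

text \<open>
  After maximising over the phase the expression is affine in \<open>|\<zeta>|^2\<close>, and because \<open>k \<ge> 1\<close> it is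
  largest at \<open>|\<zeta>| = 1\<close>.
\<close>
lemma cubic_modulus_le_phase_bound:
  assumes "m^2 = 4 * \<nu> * k" "0 < \<nu>" "1 \<le> k" "0 \<le> c" "c \<le> 1" "cmod \<zeta> \<le> 1"
  shows "cubic_modulus m \<nu> c \<zeta> \<le> phase_bound k \<nu> (c^2)"
proof -
  define t S where "t = 1 - c^2" and "S = sqrt (c^2 + k * t)"
  have t: "0 \<le> t"
    using assms by (simp add: t_def power_le_one)
  have "1 * t \<le> k * t"
    using assms(3) t by (rule mult_right_mono)
  then have "1 \<le> S"
    by (simp add: S_def t_def)
  have x: "0 \<le> 1 - (cmod \<zeta>)^2"
    using assms(6) by (simp add: power_le_one)
  have "cubic_modulus m \<nu> c \<zeta> \<le> t * (1 - (cmod \<zeta>)^2) + (\<nu> * c^2 + t * (cmod \<zeta>)^2) * S"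
    using modulus_le_phase_max[OF assms(1,2,4,5), of \<zeta>]
    by (simp add: cubic_modulus_def t_def S_def)
  also have "\<dots> \<le> t * (1 - (cmod \<zeta>)^2) * S + (\<nu> * c^2 + t * (cmod \<zeta>)^2) * S"
    using mult_left_mono[OF \<open>1 \<le> S\<close> mult_nonneg_nonneg[OF t x]] by simp
  also have "\<dots> = (\<nu> * c^2 + t) * S"
    by (simp add: algebra_simps)
  finally show ?thesis
    by (simp add: phase_bound_def t_def S_def)
qed

text \<open>
  This is the inequality of arithmetic and geometric means for \<open>p\<close>, \<open>p\<close> and a multiple of \<open>D - E p\<close>.
  Equality holds for \<open>3 E p = 2 D\<close>.
\<close>
lemma cubic_AM_GM:
  fixes D E p :: real
  assumes "0 \<le> D + 3 * E * p"
  shows "27 * E^2 * (p^2 * (D - E * p)) \<le> 4 * D^3"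
proof -
  have "4 * D^3 - 27 * E^2 * (p^2 * (D - E * p)) = (2 * D - 3 * E * p)^2 * (D + 3 * E * p)"
    by (simp add: algebra_simps power2_eq_square power3_eq_cube)
  also have "\<dots> \<ge> 0" using assms by simp
  finally show ?thesis by simp
qed

text \<open>
  This is the value of \<open>cubic_modulus\<close> at \<open>\<zeta> = 1\<close> whenever it is nonnegative.
\<close>
definition real_bound :: "real \<Rightarrow> real \<Rightarrow> real \<Rightarrow> real" where
  "real_bound m \<nu> c = c * ((1 + m) - (1 + m + \<nu>) * c^2)"

lemma real_bound_le:
  fixes m \<nu> c :: real
  assumes "0 < m" "0 < \<nu>" "0 \<le> c"
  shows "real_bound m \<nu> c \<le> 2 / 3 * (1 + m) * sqrt ((1 + m) / (3 * (1 + m + \<nu>)))"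
proof -
  define a b where "a = 1 + m" and "b = 1 + m + \<nu>"
  have pos: "0 < a" "0 < b" using assms by (auto simp: a_def b_def)
  define r where "r = a - b * c^2"
  show ?thesis
  proof (cases "0 \<le> r")
    case True
    have "27 * 1^2 * (r^2 * (a - 1 * r)) \<le> 4 * a^3"
      using True pos by (intro cubic_AM_GM) simp
    moreover have "a - 1 * r = b * c^2"
      by (simp add: r_def)
    ultimately have "27 * b * (c * r)^2 \<le> 4 * a^3"
      by (simp add: power_mult_distrib mult_ac)
    then have "(c * r)^2 \<le> (2 / 3 * a)^2 * (a / (3 * b))"
      using pos by (simp add: field_simps power2_eq_square power3_eq_cube)
    then have "sqrt ((c * r)^2) \<le> sqrt ((2 / 3 * a)^2 * (a / (3 * b)))"
      by (rule real_sqrt_le_mono)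
    then show ?thesis
      using pos True assms(3)
      unfolding real_sqrt_mult real_sqrt_abs
      by (simp add: real_bound_def r_def a_def b_def abs_mult)
  next
    case False
    then have "c * r \<le> 0" using assms(3) by (simp add: mult_nonneg_nonpos)
    moreover have "0 \<le> 2 / 3 * a * sqrt (a / (3 * b))" using pos by simp
    ultimately show ?thesis
      by (simp add: real_bound_def r_def a_def b_def)
  qed
qed

lemma real_bound_at_max:
  fixes m \<nu> :: real
  assumes "0 < m" "0 < \<nu>"
  defines "c \<equiv> sqrt ((1 + m) / (3 * (1 + m + \<nu>)))"
  shows "real_bound m \<nu> c = 2 / 3 * (1 + m) * c"
proof -
  have "c^2 = (1 + m) / (3 * (1 + m + \<nu>))"
    using assms by (simp add: c_def)
  then have e: "(1 + m + \<nu>) * c^2 = (1 + m) / 3"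
    using assms by (simp add: field_simps)
  show ?thesis
    unfolding real_bound_def e by (simp add: field_simps)
qed

text \<open>
  The value of \<open>c^2\<close> at which the stationary phase on \<open>|\<zeta>| = 1\<close> is exactly \<open>\<zeta> = 1\<close>.  For larger \<open>c^2\<close> the
  stationary point has \<open>Re \<zeta> < 1\<close>; below it, the largest modulus on the unit circle is at \<open>\<zeta> = 1\<close>.
\<close>
definition phase_threshold :: "real \<Rightarrow> real \<Rightarrow> real" where
  "phase_threshold m \<nu> = m / (4 * \<nu> + m + m * \<nu>)"

lemma phase_bound_at_threshold:
  fixes m \<nu> k :: real
  assumes "m^2 = 4 * \<nu> * k" "0 < m" "0 < \<nu>"
  defines "s \<equiv> phase_threshold m \<nu>"
  shows "phase_bound k \<nu> s = real_bound m \<nu> (sqrt s)"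
proof -
  have den: "0 < 4 * \<nu> + m + m * \<nu>" using assms by (simp add: add_pos_pos)
  have s: "0 < s" using den assms(2) by (simp add: s_def phase_threshold_def)
  have eq: "m * (1 - s) = (4 + m) * \<nu> * s"
    using den by (simp add: s_def phase_threshold_def field_simps)
  have "4 * \<nu> * (s + k * (1 - s)) = 4 * \<nu> * s + m * (m * (1 - s))"
    using assms(1) by (simp add: algebra_simps power2_eq_square)
  also have "\<dots> = 4 * \<nu> * (s * (1 + m / 2)^2)"
    unfolding eq by (simp add: algebra_simps power2_eq_square)
  finally have "s + k * (1 - s) = s * (1 + m / 2)^2"
    using assms(3) by simp
  then have "phase_bound k \<nu> s = (\<nu> * s + (1 - s)) * (sqrt s * (1 + m / 2))"
    using assms(2) by (simp add: phase_bound_def real_sqrt_mult)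
  also have "\<dots> = sqrt s * ((1 + m) * (1 - s) - \<nu> * s)"
  proof -
    have "(\<nu> * s + (1 - s)) * (1 + m / 2) = (1 + m) * (1 - s) - \<nu> * s"
      using eq by (simp add: field_simps)
    then show ?thesis by (simp add: mult.assoc mult.left_commute)
  qed
  finally show ?thesis
    using s by (simp add: real_bound_def algebra_simps)
qed

lemma phase_bound_sq:
  assumes "0 \<le> s" "s \<le> 1" "0 \<le> k"
  shows "(phase_bound k \<nu> s)^2 = (1 + (\<nu> - 1) * s)^2 * (k - (k - 1) * s)"
proof -
  have "0 \<le> s + k * (1 - s)" using assms by simp
  then have "(phase_bound k \<nu> s)^2 = (\<nu> * s + (1 - s))^2 * (s + k * (1 - s))"
    by (simp add: phase_bound_def power_mult_distrib)
  also have "\<nu> * s + (1 - s) = 1 + (\<nu> - 1) * s" by (simp add: algebra_simps)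
  also have "s + k * (1 - s) = k - (k - 1) * s" by (simp add: algebra_simps)
  finally show ?thesis .
qed

lemma phase_bound_nonneg:
  assumes "0 \<le> s" "s \<le> 1" "0 \<le> k" "0 \<le> \<nu>"
  shows "0 \<le> phase_bound k \<nu> s"
  unfolding phase_bound_def using assms
  by (intro mult_nonneg_nonneg add_nonneg_nonneg real_sqrt_ge_zero) simp_all

text \<open>
  The square of the phase bound is a cubic in \<open>s\<close>.  If it is nonincreasing at \<open>r\<close>, which is what the
  last hypothesis says when \<open>\<nu> > 1\<close>, then it stays so on \<open>[r, 1]\<close>.
\<close>
lemma phase_bound_antimono:
  fixes k \<nu> r s :: real
  assumes "1 \<le> k" "0 < \<nu>" "0 \<le> r" "r \<le> s" "s \<le> 1"
    and crit: "1 < \<nu> \<Longrightarrow> 2 * (\<nu> - 1) * (k - (k - 1) * r) \<le> (k - 1) * (1 + (\<nu> - 1) * r)"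
  shows "phase_bound k \<nu> s \<le> phase_bound k \<nu> r"
proof -
  define \<beta> \<kappa> where "\<beta> = \<nu> - 1" and "\<kappa> = k - 1"
  define p q where "p = 1 + \<beta> * r" and "q = k - \<kappa> * r"
  have \<kappa>: "0 \<le> \<kappa>" using assms(1-5) by (simp add: \<kappa>_def)
  have ps: "0 \<le> 1 + \<beta> * s"
  proof -
    have "1 + \<beta> * s = \<nu> * s + (1 - s)" by (simp add: \<beta>_def algebra_simps)
    moreover have "0 \<le> \<nu> * s" using assms(1-5) by simp
    ultimately show ?thesis using assms(5) by linarith
  qed
  have qs: "0 \<le> k - \<kappa> * s"
  proof -
    have "k - \<kappa> * s = s + k * (1 - s)" by (simp add: \<kappa>_def algebra_simps)
    moreover have "0 \<le> k * (1 - s)" using assms(1-5) by simp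
    ultimately show ?thesis using assms(1-5) by linarith
  qed
  have qsr: "k - \<kappa> * s \<le> q"
    using assms(1-5) \<kappa> by (simp add: q_def mult_left_mono)
  have "(1 + \<beta> * s)^2 * (k - \<kappa> * s) \<le> p^2 * q"
  proof (cases "1 < \<nu>")
    case False
    then have "\<beta> \<le> 0" by (simp add: \<beta>_def)
    then have "1 + \<beta> * s \<le> p"
      using assms(1-5) by (simp add: p_def mult_left_mono_neg)
    then show ?thesis
      using ps qs qsr by (intro mult_mono power_mono) auto
  next
    case True
    then have \<beta>: "0 \<le> \<beta>" by (simp add: \<beta>_def)
    have c: "2 * \<beta> * q \<le> \<kappa> * p"
      using crit[OF True] by (simp add: p_def q_def \<beta>_def \<kappa>_def)
    have p: "0 \<le> p" using \<beta> assms by (simp add: p_def)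
    define d where "d = s - r"
    have d: "0 \<le> d" using assms(1-5) by (simp add: d_def)
    have e: "1 + \<beta> * s = p + \<beta> * d" "k - \<kappa> * s = q - \<kappa> * d"
      by (simp_all add: p_def q_def d_def algebra_simps)
    have "p^2 * q - (p + \<beta> * d)^2 * (q - \<kappa> * d) =
        d * p * (\<kappa> * p - 2 * \<beta> * q) + \<beta> * d^2 * (\<kappa> * p - 2 * \<beta> * q) / 2 +
        3 / 2 * \<beta> * \<kappa> * p * d^2 + \<kappa> * \<beta>^2 * d^3"
      by (simp add: field_simps power2_eq_square power3_eq_cube)
    also have "\<dots> \<ge> 0"
      using c p d \<beta> \<kappa> by simp
    finally show ?thesis unfolding e by simp
  qed
  then have "(phase_bound k \<nu> s)^2 \<le> (phase_bound k \<nu> r)^2"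
    using assms(1-5) by (simp add: phase_bound_sq \<beta>_def \<kappa>_def p_def q_def)
  then show ?thesis
    by (rule power2_le_imp_le) (use assms(1-5) in \<open>intro phase_bound_nonneg; simp\<close>)
qed

text \<open>
  For \<open>c < 1\<close> the left-hand side is the maximum over real \<open>x\<close> of the expression bounded in
  \<open>positive_endpoint_le\<close>.  It has the form \<open>1 + c^2 (a + b c)\<close> with \<open>b \<ge> 0\<close>, so where it exceeds \<open>1\<close> it increases with \<open>c\<close>.  At the
  right end \<open>c = 2 / (2 + m)\<close> the maximising \<open>x\<close> is \<open>1\<close>, where it agrees with \<open>real_bound\<close>.
\<close>
lemma vertex_bound_le:
  fixes m \<nu> c K :: real
  assumes "0 < m" "4 * \<nu> \<le> m^2" "0 \<le> c" "c \<le> 2 / (2 + m)"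
    and "1 \<le> K" "real_bound m \<nu> (2 / (2 + m)) \<le> K"
  shows "1 + c^2 * ((m^2 / 4 - 1) + (m^2 / 4 - \<nu>) * c) \<le> K"
proof -
  define c0 where "c0 = 2 / (2 + m)"
  have "2 + m \<noteq> 0" using assms by simp
  then have c0m: "c0 * (2 + m) = 2"
    using nonzero_eq_divide_eq[of "2 + m" c0 2] c0_def by blast
  have b: "0 \<le> m^2 / 4 - \<nu>" using assms by simp
  show ?thesis
  proof (cases "0 \<le> (m^2 / 4 - 1) + (m^2 / 4 - \<nu>) * c")
    case True
    have le: "(m^2 / 4 - \<nu>) * c \<le> (m^2 / 4 - \<nu>) * c0"
      by (rule mult_left_mono) (use assms b in \<open>auto simp: c0_def\<close>)
    have "c^2 * ((m^2 / 4 - 1) + (m^2 / 4 - \<nu>) * c) \<le> c0^2 * ((m^2 / 4 - 1) + (m^2 / 4 - \<nu>) * c0)"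
      using assms True le by (intro mult_mono power_mono) (auto simp: c0_def)
    moreover have "1 + c0^2 * ((m^2 / 4 - 1) + (m^2 / 4 - \<nu>) * c0) = real_bound m \<nu> c0"
    proof -
      have m: "m * c0 = 2 - 2 * c0" using c0m by (simp add: algebra_simps)
      have m2: "m^2 * c0^2 = (2 - 2 * c0)^2" unfolding m[symmetric] by (simp add: power_mult_distrib)
      have "1 + c0^2 * ((m^2 / 4 - 1) + (m^2 / 4 - \<nu>) * c0) =
          1 + (m^2 * c0^2) / 4 - c0^2 + (m^2 * c0^2) / 4 * c0 - \<nu> * c0^3"
        by (simp add: field_simps power2_eq_square power3_eq_cube)
      also have "\<dots> = c0 + m * c0 - c0^3 - (m * c0) * c0^2 - \<nu> * c0^3"
        unfolding m2 m by (simp add: field_simps power2_eq_square power3_eq_cube)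
      also have "\<dots> = real_bound m \<nu> c0"
        by (simp add: real_bound_def field_simps power2_eq_square power3_eq_cube)
      finally show ?thesis .
    qed
    ultimately show ?thesis
      using assms(6) by (simp add: c0_def)
  next
    case False
    then have "c^2 * ((m^2 / 4 - 1) + (m^2 / 4 - \<nu>) * c) \<le> 0"
      by (simp add: mult_nonneg_nonpos)
    then show ?thesis using assms(5) by linarith
  qed
qed

text \<open>
  The objective at \<open>\<zeta> = x\<close>, with the sign of the modulus resolved as is right when the quadratic terms
  dominate.  For \<open>c \<le> 2 / (2 + m)\<close> the parabola in \<open>x\<close> has its vertex in \<open>[0, 1]\<close>; for larger \<open>c\<close> it
  increases up to \<open>x = 1\<close>.
\<close>
lemma positive_endpoint_le:
  fixes m \<nu> c x K :: real
  assumes "0 < m" "4 * \<nu> \<le> m^2" "0 \<le> c" "c \<le> 1" "0 \<le> x" "x \<le> 1" "1 \<le> K"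
    and K: "\<And>c. 0 \<le> c \<Longrightarrow> c \<le> 1 \<Longrightarrow> real_bound m \<nu> c \<le> K"
  shows "(1 - c^2) * (1 - x^2) +
    c * ((1 - c^2) * x^2 - \<nu> * c^2 + m * (1 - c^2) * x) \<le> K"
proof (cases "c \<le> 2 / (2 + m)")
  case True
  then have "c < 1"
    using assms by (smt (verit) divide_less_eq_1_pos)
  have "(1 - c) * (c * m * x - (1 - c) * x^2) \<le> c^2 * m^2 / 4"
    using zero_le_power2[of "(1 - c) * x - c * m / 2"]
    by (simp add: field_simps power2_eq_square)
  then have "(1 + c) * ((1 - c) * (c * m * x - (1 - c) * x^2)) \<le> (1 + c) * (c^2 * m^2 / 4)"
    using assms by (intro mult_left_mono) auto
  then have "(1 - c^2) * (1 - x^2) + c * ((1 - c^2) * x^2 - \<nu> * c^2 + m * (1 - c^2) * x) \<le>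
      1 + c^2 * ((m^2 / 4 - 1) + (m^2 / 4 - \<nu>) * c)"
    by (simp add: field_simps power2_eq_square)
  also have "\<dots> \<le> K"
  proof (rule vertex_bound_le[OF assms(1,2,3) True \<open>1 \<le> K\<close>])
    show "real_bound m \<nu> (2 / (2 + m)) \<le> K"
      by (rule K) (use assms(1) in simp_all)
  qed
  finally show ?thesis .
next
  case False
  then have c: "2 * (1 - c) \<le> c * m"
    using assms by (simp add: field_simps)
  have "(1 - c) * (1 + x) \<le> (1 - c) * 2"
    using assms by (intro mult_left_mono) auto
  with c have "(1 - c) * (1 + x) \<le> c * m" by simp
  then have "(1 - c^2) * (1 - x) * ((1 - c) * (1 + x)) \<le> (1 - c^2) * (1 - x) * (c * m)"
    using assms by (intro mult_left_mono) (auto simp: power_le_one)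
  then have "(1 - c^2) * (1 - x^2) + c * ((1 - c^2) * x^2 - \<nu> * c^2 + m * (1 - c^2) * x) \<le>
      real_bound m \<nu> c"
    by (simp add: real_bound_def algebra_simps power2_eq_square)
  also have "\<dots> \<le> K"
    by (rule K[OF assms(3,4)])
  finally show ?thesis .
qed

text \<open>
  The objective at \<open>\<zeta> = -x\<close>.  For \<open>c \<le> 2 / (2 + m)\<close> its vertex value is smaller than that on the positive
  side.  For larger \<open>c\<close> it is compared with \<open>real_bound\<close> at the same \<open>c\<close>: below the phase threshold
  \<open>\<nu> c^2\<close> is at most \<open>m (1 - c^2) / (m + 4)\<close>, and then the difference is controlled by a polynomial that
  vanishes at \<open>c = 2 / (2 + m)\<close>.
\<close>
lemma negative_endpoint_le:
  fixes m \<nu> c x K :: real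
  assumes "0 < m" "m \<le> 4" "4 * \<nu> \<le> m^2" "0 < \<nu>" "0 \<le> c" "c \<le> 1" "0 \<le> x" "x \<le> 1" "1 \<le> K"
    and K: "\<And>c. 0 \<le> c \<Longrightarrow> c \<le> 1 \<Longrightarrow> real_bound m \<nu> c \<le> K"
    and below: "4 * \<nu> * c^2 \<le> m * (1 - c^2 - \<nu> * c^2)"
  shows "(1 - c^2) * (1 - x^2) +
    c * (\<nu> * c^2 - (1 - c^2) * x^2 + m * (1 - c^2) * x) \<le> K"
proof -
  have sq: "(1 + c) * (c * m * x - (1 + c) * x^2) \<le> c^2 * m^2 / 4"
    using zero_le_power2[of "(1 + c) * x - c * m / 2"]
    by (simp add: field_simps power2_eq_square)
  show ?thesis
  proof (cases "c \<le> 2 / (2 + m)")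
    case True
    have "(1 - c) * ((1 + c) * (c * m * x - (1 + c) * x^2)) \<le> (1 - c) * (c^2 * m^2 / 4)"
      using assms(6) sq by (intro mult_left_mono) simp_all
    then have "(1 - c^2) * (1 - x^2) + c * (\<nu> * c^2 - (1 - c^2) * x^2 + m * (1 - c^2) * x) \<le>
        1 + c^2 * ((m^2 / 4 - 1) - (m^2 / 4 - \<nu>) * c)"
      by (simp add: field_simps power2_eq_square)
    also have "\<dots> \<le> 1 + c^2 * ((m^2 / 4 - 1) + (m^2 / 4 - \<nu>) * c)"
    proof -
      have "0 \<le> (m^2 / 4 - \<nu>) * c" using assms(3,5) by simp
      then show ?thesis by (intro add_left_mono mult_left_mono) simp_all
    qed
    also have "\<dots> \<le> K"
    proof (rule vertex_bound_le[OF assms(1,3,5) True \<open>1 \<le> K\<close>])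
      show "real_bound m \<nu> (2 / (2 + m)) \<le> K"
        by (rule K) (use assms(1) in simp_all)
    qed
    finally show ?thesis .
  next
    case False
    then have c: "0 \<le> (2 + m) * c - 2"
      using assms(1) by (simp add: field_simps)
    have t: "0 \<le> 1 - c^2" using assms(5,6) by (simp add: power_le_one)
    have "(m + 4) * (4 * (1 + c) * (c * (m + 1) - 1) - c^2 * m^2) - 8 * c * m * (1 + c) =
        ((2 + m) * c - 2) * ((m + 2) * (4 - m) * c + 2 * (m + 4))"
      by (simp add: algebra_simps power2_eq_square)
    also have "\<dots> \<ge> 0"
      using c assms(1,2,5) by (intro mult_nonneg_nonneg add_nonneg_nonneg) simp_all
    finally have f: "8 * c * m * (1 + c) \<le> (m + 4) * (4 * (1 + c) * (c * (m + 1) - 1) - c^2 * m^2)"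
      by simp
    define Y where "Y = c * (m + 1) - 1 - (c * m * x - (1 + c) * x^2)"
    have "4 * (1 + c) * (c * m * x - (1 + c) * x^2) \<le> c^2 * m^2"
      using sq unfolding mult.assoc by linarith
    then have "4 * (1 + c) * (c * (m + 1) - 1) - c^2 * m^2 \<le> 4 * (1 + c) * Y"
      unfolding Y_def right_diff_distrib by linarith
    then have "(m + 4) * (4 * (1 + c) * (c * (m + 1) - 1) - c^2 * m^2) \<le> (m + 4) * (4 * (1 + c) * Y)"
      by (rule mult_left_mono) (use assms(1) in simp)
    with f have "8 * c * m * (1 + c) \<le> (m + 4) * (4 * (1 + c) * Y)"
      by (rule order_trans)
    then have "(4 * (1 + c)) * (2 * c * m) \<le> (4 * (1 + c)) * ((m + 4) * Y)"
      by (simp add: mult_ac)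
    then have Y: "2 * c * m \<le> (m + 4) * Y"
      by (rule mult_left_le_imp_le) (use assms(5) in simp)
    have "(m + 4) * (\<nu> * c^2) \<le> m * (1 - c^2)"
      using below by (simp add: algebra_simps)
    then have "2 * c * ((m + 4) * (\<nu> * c^2)) \<le> 2 * c * (m * (1 - c^2))"
      by (rule mult_left_mono) (use assms(5) in simp)
    also have "\<dots> = (1 - c^2) * (2 * c * m)"
      by simp
    also have "\<dots> \<le> (1 - c^2) * ((m + 4) * Y)"
      using Y t by (rule mult_left_mono)
    finally have "(m + 4) * (2 * c * (\<nu> * c^2)) \<le> (m + 4) * ((1 - c^2) * Y)"
      by (simp only: mult_ac)
    then have "2 * c * (\<nu> * c^2) \<le> (1 - c^2) * Y"
      by (rule mult_left_le_imp_le) (use assms(1) in simp)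
    moreover have "real_bound m \<nu> c - ((1 - c^2) * (1 - x^2) +
        c * (\<nu> * c^2 - (1 - c^2) * x^2 + m * (1 - c^2) * x)) = (1 - c^2) * Y - 2 * c * (\<nu> * c^2)"
      by (simp add: real_bound_def Y_def algebra_simps power2_eq_square)
    ultimately have "(1 - c^2) * (1 - x^2) + c * (\<nu> * c^2 - (1 - c^2) * x^2 + m * (1 - c^2) * x) \<le>
        real_bound m \<nu> c"
      by linarith
    also have "\<dots> \<le> K"
      by (rule K[OF assms(5,6)])
    finally show ?thesis .
  qed
qed

text \<open>
  Enlarging the radius moves the stationary phase until it reaches the positive real axis.
\<close>
lemma boundary_radius_exists:
  fixes A m t x :: real
  assumes "x \<le> 1" "m * (t * x^2 - A) \<le> 4 * A * x" "4 * A \<le> m * (t - A)"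
  obtains y where "x \<le> y" "y \<le> 1" "m * (t * y^2 - A) = 4 * A * y"
proof -
  have "\<exists>y. x \<le> y \<and> y \<le> 1 \<and> m * (t * y^2 - A) - 4 * A * y = 0"
    by (rule IVT') (use assms in \<open>auto intro!: continuous_intros\<close>)
  then show ?thesis using that by auto
qed

text \<open>
  Below the threshold the quadratic in \<open>Re \<zeta>\<close> is largest at \<open>\<zeta> = |\<zeta>|\<close>, at \<open>\<zeta> = -|\<zeta>|\<close> or at an interior
  stationary point.  In the last case the estimate is nondecreasing in \<open>|\<zeta>|\<close>, and increasing \<open>|\<zeta>|\<close> until the
  stationary point becomes real reduces it to the first case.
\<close>
lemma cubic_modulus_le_below_threshold:
  fixes m \<nu> k c K :: real and \<zeta> :: complex
  assumes mk: "m^2 = 4 * \<nu> * k" and m: "0 < m" "m \<le> 4" and \<nu>: "0 < \<nu>" and k: "1 \<le> k"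
    and c: "0 \<le> c" "c \<le> 1" and \<zeta>: "cmod \<zeta> \<le> 1" and "1 \<le> K"
    and K: "\<And>c. 0 \<le> c \<Longrightarrow> c \<le> 1 \<Longrightarrow> real_bound m \<nu> c \<le> K"
    and below: "4 * \<nu> * c^2 \<le> m * (1 - c^2 - \<nu> * c^2)"
  shows "cubic_modulus m \<nu> c \<zeta> \<le> K"
proof -
  define t A x X where "t = 1 - c^2" and "A = \<nu> * c^2" and "x = cmod \<zeta>" and "X = Re \<zeta>"
  define M where "M = cmod (of_real A - of_real (m * t) * \<zeta> - of_real t * \<zeta>^2)"
  have t: "0 \<le> t" using c by (simp add: t_def power_le_one)
  have A: "0 \<le> A" using \<nu> by (simp add: A_def)
  have x: "0 \<le> x" "x \<le> 1" using \<zeta> by (auto simp: x_def)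
  have X: "\<bar>X\<bar> \<le> x" by (simp add: X_def x_def abs_Re_le_cmod)
  have "1 * (4 * \<nu>) \<le> k * (4 * \<nu>)"
    using k \<nu> by (intro mult_right_mono) auto
  then have m\<nu>: "4 * \<nu> \<le> m^2" by (simp add: mk mult_ac)
  have G: "cubic_modulus m \<nu> c \<zeta> = t * (1 - x^2) + c * M"
    by (simp add: cubic_modulus_def M_def t_def A_def x_def)
  have M: "M^2 = (A + t * x^2)^2 + m^2 * t * (t * x^2) - 2 * t * m * (A - t * x^2) * X - 4 * t * A * X^2"
    unfolding M_def x_def X_def by (rule quadratic_norm_sq)
  consider (pos) "4 * A * x \<le> m * (t * x^2 - A)" | (neg) "4 * A * x \<le> m * (A - t * x^2)"
    | (int) "m * (t * x^2 - A) \<le> 4 * A * x"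
    by linarith
  then show ?thesis
  proof cases
    case pos
    have "(t * x^2 - A + m * t * x)^2 - M^2 = t * (x - X) * (2 * (m * (t * x^2 - A)) - 4 * A * (x + X))"
      unfolding M by (simp add: algebra_simps power2_eq_square)
    also have "\<dots> \<ge> 0"
    proof -
      have "4 * A * (x + X) \<le> 4 * A * (2 * x)" using A X by (intro mult_left_mono) auto
      then show ?thesis using t X pos by (intro mult_nonneg_nonneg) auto
    qed
    finally have "M^2 \<le> (t * x^2 - A + m * t * x)^2" by simp
    moreover have "0 \<le> t * x^2 - A + m * t * x"
    proof -
      have "0 \<le> m * (t * x^2 - A)" using pos A x by (smt (verit) mult_nonneg_nonneg)
      then have "0 \<le> t * x^2 - A" using m by (simp add: zero_le_mult_iff)
      then show ?thesis using m t x by simp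
    qed
    ultimately have "M \<le> t * x^2 - A + m * t * x" by (rule power2_le_imp_le)
    then have "c * M \<le> c * (t * x^2 - A + m * t * x)" using c by (intro mult_left_mono)
    moreover have "t * (1 - x^2) + c * (t * x^2 - A + m * t * x) \<le> K"
      unfolding t_def A_def using m m\<nu> c x K \<open>1 \<le> K\<close> by (intro positive_endpoint_le) auto
    ultimately show ?thesis unfolding G by linarith
  next
    case neg
    have "(A - t * x^2 + m * t * x)^2 - M^2 = t * (x + X) * (2 * (m * (A - t * x^2)) - 4 * A * (x - X))"
      unfolding M by (simp add: algebra_simps power2_eq_square)
    also have "\<dots> \<ge> 0"
    proof -
      have "4 * A * (x - X) \<le> 4 * A * (2 * x)" using A X by (intro mult_left_mono) auto
      then show ?thesis using t X neg by (intro mult_nonneg_nonneg) auto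
    qed
    finally have "M^2 \<le> (A - t * x^2 + m * t * x)^2" by simp
    moreover have "0 \<le> A - t * x^2 + m * t * x"
    proof -
      have "0 \<le> m * (A - t * x^2)" using neg A x by (smt (verit) mult_nonneg_nonneg)
      then have "0 \<le> A - t * x^2" using m by (simp add: zero_le_mult_iff)
      then show ?thesis using m t x by simp
    qed
    ultimately have "M \<le> A - t * x^2 + m * t * x" by (rule power2_le_imp_le)
    then have "c * M \<le> c * (A - t * x^2 + m * t * x)" using c by (intro mult_left_mono)
    moreover have "t * (1 - x^2) + c * (A - t * x^2 + m * t * x) \<le> K"
      unfolding t_def A_def using m m\<nu> \<nu> c x K below \<open>1 \<le> K\<close> by (intro negative_endpoint_le) auto
    ultimately show ?thesis unfolding G by linarith
  next
    case int
    have "4 * A \<le> m * (t - A)"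
      using below by (simp add: A_def t_def)
    then obtain y where y: "x \<le> y" "y \<le> 1" "m * (t * y^2 - A) = 4 * A * y"
      using boundary_radius_exists[OF x(2) int] by blast
    define S where "S = sqrt (c^2 + k * t)"
    have S2: "S^2 = c^2 + k * t" using k t by (simp add: S_def)
    have "1 * t \<le> k * t" using k t by (rule mult_right_mono)
    then have S1: "1 \<le> S" by (simp add: S_def t_def)
    have "0 \<le> m * (t * y^2 - A)" using y A x by simp
    then have Cy: "0 \<le> t * y^2 - A" using m by (simp add: zero_le_mult_iff)
    \<comment> \<open>At radius \<open>y\<close> the stationary real part is exactly \<open>y\<close>, so there the bound by the phase
      maximum coincides with the value at the positive real point.\<close>
    have "4 * \<nu> * ((A + t * y^2)^2 * (c^2 + k * t) - c^2 * (t * y^2 - A + m * t * y)^2) =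
        t * (m * (A - t * y^2) + 4 * A * y)^2"
      using interior_identity[OF mk, of "c^2" "t * y^2" t y]
      by (simp add: A_def algebra_simps power2_eq_square)
    also have "\<dots> = 0" using y(3) by (simp add: algebra_simps)
    finally have "((A + t * y^2) * S)^2 = (c * (t * y^2 - A + m * t * y))^2"
      using \<nu> by (simp add: S2 power_mult_distrib)
    moreover have "0 \<le> (A + t * y^2) * S" "0 \<le> c * (t * y^2 - A + m * t * y)"
    proof -
      have "0 \<le> y" using x y by simp
      then show "0 \<le> (A + t * y^2) * S" "0 \<le> c * (t * y^2 - A + m * t * y)"
        using A t S1 c Cy m by simp_all
    qed
    ultimately have eq: "(A + t * y^2) * S = c * (t * y^2 - A + m * t * y)"
      by (rule power2_eq_imp_eq)
    have "c * M \<le> (A + t * x^2) * S"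
      using modulus_le_phase_max[OF mk \<nu> c, of \<zeta>]
      by (simp add: M_def A_def t_def S_def x_def)
    then have "cubic_modulus m \<nu> c \<zeta> \<le> t + A * S + t * x^2 * (S - 1)"
      unfolding G by (simp add: algebra_simps)
    also have "\<dots> \<le> t + A * S + t * y^2 * (S - 1)"
      using t S1 x y by (intro add_left_mono mult_right_mono mult_left_mono power_mono) auto
    also have "\<dots> = t * (1 - y^2) + c * (t * y^2 - A + m * t * y)"
      unfolding eq[symmetric] by (simp add: algebra_simps)
    also have "\<dots> \<le> K"
      unfolding t_def A_def using m m\<nu> c x y K \<open>1 \<le> K\<close> by (intro positive_endpoint_le) auto
    finally show ?thesis .
  qed
qed

text \<open>
  Above the threshold the phase bound is nonincreasing, and at the threshold it equals a value of
  \<open>real_bound\<close>.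
\<close>
lemma cubic_modulus_le:
  fixes m \<nu> k c K :: real and \<zeta> :: complex
  assumes mk: "m^2 = 4 * \<nu> * k" and m: "0 < m" "m \<le> 4" and \<nu>: "0 < \<nu>" and k: "1 \<le> k"
    and c: "0 \<le> c" "c \<le> 1" and \<zeta>: "cmod \<zeta> \<le> 1" and "1 \<le> K"
    and K: "\<And>c. 0 \<le> c \<Longrightarrow> c \<le> 1 \<Longrightarrow> real_bound m \<nu> c \<le> K"
    and crit: "1 < \<nu> \<Longrightarrow> 2 * (\<nu> - 1) * (k - (k - 1) * phase_threshold m \<nu>)
                 \<le> (k - 1) * (1 + (\<nu> - 1) * phase_threshold m \<nu>)"
  shows "cubic_modulus m \<nu> c \<zeta> \<le> K"
proof (cases "phase_threshold m \<nu> \<le> c^2")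
  case True
  define r where "r = phase_threshold m \<nu>"
  have r: "0 \<le> r" "r \<le> 1"
    using m \<nu> by (auto simp: r_def phase_threshold_def intro!: add_nonneg_nonneg divide_nonneg_nonneg divide_le_eq_1_pos[THEN iffD2] add_pos_pos)
  have "cubic_modulus m \<nu> c \<zeta> \<le> phase_bound k \<nu> (c^2)"
    using assms(1-8) by (intro cubic_modulus_le_phase_bound) simp_all
  also have "\<dots> \<le> phase_bound k \<nu> r"
  proof (rule phase_bound_antimono[OF k \<nu> r(1)])
    show "r \<le> c^2" using True by (simp add: r_def)
    show "c^2 \<le> 1" using c by (simp add: power_le_one)
  qed (use crit in \<open>simp add: r_def\<close>)
  also have "\<dots> = real_bound m \<nu> (sqrt r)"
    using phase_bound_at_threshold[OF mk m(1) \<nu>] by (simp add: r_def)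
  also have "\<dots> \<le> K"
    using r by (intro K) auto
  finally show ?thesis .
next
  case False
  have den: "0 < 4 * \<nu> + m + m * \<nu>" using m \<nu> by (simp add: add_pos_pos)
  from False have "c^2 * (4 * \<nu> + m + m * \<nu>) \<le> m"
    using den by (simp add: phase_threshold_def field_simps)
  then have below: "4 * \<nu> * c^2 \<le> m * (1 - c^2 - \<nu> * c^2)"
    by (simp add: algebra_simps)
  show ?thesis
    by (rule cubic_modulus_le_below_threshold[OF mk m \<nu> k c \<zeta> \<open>1 \<le> K\<close> _ below]) (rule K)
qed

text \<open>
  With \<open>t = 1 - s\<close> and \<open>\<delta> = 1 - 1/\<nu>\<close> the hypothesis reads \<open>k - 1 \<le> 2\<delta>\<close>, and
  \<open>(1 - \<delta> t)^2 (1 + 2 \<delta> t) \<le> 1\<close> on \<open>[0, 1]\<close>.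
\<close>
lemma phase_bound_le_endpoint:
  fixes k \<nu> s :: real
  assumes "1 \<le> k" "1 < \<nu>" "0 \<le> s" "s \<le> 1" "\<nu> * (k - 1) \<le> 2 * (\<nu> - 1)"
  shows "phase_bound k \<nu> s \<le> \<nu>"
proof -
  define \<delta> t where "\<delta> = (\<nu> - 1) / \<nu>" and "t = 1 - s"
  have t: "0 \<le> t" "t \<le> 1" using assms by (auto simp: t_def)
  have \<delta>: "0 \<le> \<delta>" "\<delta> \<le> 1" "k - 1 \<le> 2 * \<delta>"
    using assms by (auto simp: \<delta>_def field_simps)
  have "(1 - \<delta> * t)^2 * (1 + (k - 1) * t) \<le> (1 - \<delta> * t)^2 * (1 + 2 * \<delta> * t)"
    using t \<delta> by (intro mult_left_mono add_left_mono mult_right_mono) auto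
  also have "\<dots> = 1 - \<delta>^2 * t^2 * (3 - 2 * (\<delta> * t))"
    by (simp add: algebra_simps power2_eq_square)
  also have "\<dots> \<le> 1"
    using t \<delta> mult_le_one[of \<delta> t] by simp
  finally have *: "(1 - \<delta> * t)^2 * (1 + (k - 1) * t) \<le> 1" .
  have "1 + (\<nu> - 1) * s = \<nu> * (1 - \<delta> * t)"
    using assms by (simp add: \<delta>_def t_def field_simps)
  moreover have "k - (k - 1) * s = 1 + (k - 1) * t"
    by (simp add: t_def algebra_simps)
  ultimately have "(phase_bound k \<nu> s)^2 = \<nu>^2 * ((1 - \<delta> * t)^2 * (1 + (k - 1) * t))"
    using assms by (simp add: phase_bound_sq power_mult_distrib)
  also have "\<dots> \<le> \<nu>^2 * 1"
    using * by (intro mult_left_mono) auto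
  finally have "(phase_bound k \<nu> s)^2 \<le> \<nu>^2" by simp
  then show ?thesis
    by (rule power2_le_imp_le) (use assms in simp)
qed

lemma phase_bound_sq_le:
  fixes k \<nu> s :: real
  assumes "1 < k" "1 < \<nu>" "0 \<le> s" "s \<le> 1"
  shows "(phase_bound k \<nu> s)^2 \<le> 4 * (k * \<nu> - 1)^3 / (27 * (k - 1)^2 * (\<nu> - 1))"
proof -
  define p where "p = 1 + (\<nu> - 1) * s"
  have p: "0 \<le> p" using assms by (simp add: p_def)
  have "1 * 1 \<le> k * \<nu>" using assms by (intro mult_mono) auto
  then have "27 * (k - 1)^2 * (p^2 * ((k * \<nu> - 1) - (k - 1) * p)) \<le> 4 * (k * \<nu> - 1)^3"
    using assms p by (intro cubic_AM_GM add_nonneg_nonneg mult_nonneg_nonneg) simp_all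
  moreover have "(k * \<nu> - 1) - (k - 1) * p = (\<nu> - 1) * (k - (k - 1) * s)"
    by (simp add: p_def algebra_simps)
  ultimately have "27 * (k - 1)^2 * (\<nu> - 1) * (phase_bound k \<nu> s)^2 \<le> 4 * (k * \<nu> - 1)^3"
    using assms by (simp add: phase_bound_sq p_def mult_ac)
  moreover have "0 < 27 * (k - 1)^2 * (\<nu> - 1)"
    using assms by simp
  ultimately show ?thesis
    by (subst pos_le_divide_eq) (simp_all only: mult_ac)
qed

text \<open>
  The point \<open>s\<close> is the equality case of \<open>cubic_AM_GM\<close> for \<open>p = 1 + (\<nu> - 1) s\<close>.
\<close>
lemma phase_bound_sq_at_max:
  fixes k \<nu> :: real
  assumes "1 < k" "1 < \<nu>"
  defines "s \<equiv> (2 * (\<nu> - 1) * k - (k - 1)) / (3 * (\<nu> - 1) * (k - 1))"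
  assumes "0 \<le> s" "s \<le> 1"
  shows "(phase_bound k \<nu> s)^2 = 4 * (k * \<nu> - 1)^3 / (27 * (k - 1)^2 * (\<nu> - 1))"
proof -
  define D where "D = k * \<nu> - 1"
  have D: "D = k * (\<nu> - 1) + (k - 1)"
    by (simp add: D_def algebra_simps)
  have cancel: "b * (N / (3 * b * j)) = N / (3 * j)" "j * (N / (3 * b * j)) = N / (3 * b)"
    if "b \<noteq> 0" "j \<noteq> 0" for b j N :: real
    using that by simp_all
  have "(\<nu> - 1) * s = (2 * (\<nu> - 1) * k - (k - 1)) / (3 * (k - 1))"
    unfolding s_def by (rule cancel) (use assms(1,2) in simp_all)
  then have p: "1 + (\<nu> - 1) * s = 2 * D / (3 * (k - 1))"
    using assms(1) unfolding D by (simp add: field_simps)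
  have "(k - 1) * s = (2 * (\<nu> - 1) * k - (k - 1)) / (3 * (\<nu> - 1))"
    unfolding s_def by (rule cancel) (use assms(1,2) in simp_all)
  then have q: "k - (k - 1) * s = D / (3 * (\<nu> - 1))"
    using assms(2) unfolding D by (simp add: field_simps)
  have "(phase_bound k \<nu> s)^2 = (2 * D / (3 * (k - 1)))^2 * (D / (3 * (\<nu> - 1)))"
    using assms(1,4,5) by (simp add: phase_bound_sq p q)
  also have "\<dots> = 4 * D^3 / (27 * (k - 1)^2 * (\<nu> - 1))"
  proof -
    have "(2 * D / (3 * j))^2 * (D / (3 * b)) = 4 * D^3 / (27 * j^2 * b)" for j b :: real
      by (simp add: power2_eq_square power3_eq_cube)
    then show ?thesis .
  qed
  finally show ?thesis
    unfolding D_def .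
qed

text \<open>
  On \<open>|\<zeta>| = 1\<close> the stationary real part is \<open>X = m (t - A) / (4 A)\<close> with \<open>t = 1 - c^2\<close> and \<open>A = \<nu> c^2\<close>.  It is at
  most \<open>1\<close> above the threshold and at least \<open>-1\<close> because \<open>m \<le> 4\<close>.
\<close>
lemma cubic_modulus_attains_phase_bound:
  fixes m \<nu> k c :: real
  assumes mk: "m^2 = 4 * \<nu> * k" and "0 < m" "m \<le> 4" "0 < \<nu>" "0 \<le> k" "0 < c" "c \<le> 1"
    and above: "m * (1 - c^2 - \<nu> * c^2) \<le> 4 * \<nu> * c^2"
  obtains \<zeta> where "cmod \<zeta> = 1" "cubic_modulus m \<nu> c \<zeta> = phase_bound k \<nu> (c^2)"
proof -
  define t A where "t = 1 - c^2" and "A = \<nu> * c^2"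
  have t: "0 \<le> t" using assms by (simp add: t_def power_le_one)
  have A: "0 < A" using assms by (simp add: A_def)
  define X where "X = m * (t - A) / (4 * A)"
  have "m * (t - A) \<le> 4 * A" using above by (simp add: t_def A_def)
  moreover have "- (4 * A) \<le> m * (t - A)"
  proof -
    have "m * A \<le> 4 * A" using assms A by (intro mult_right_mono) auto
    moreover have "0 \<le> m * t" using assms t by simp
    ultimately show ?thesis by (simp add: algebra_simps)
  qed
  ultimately have "\<bar>X\<bar> \<le> 1" using A by (simp add: X_def abs_le_iff divide_le_eq le_divide_eq)
  then have X: "X^2 \<le> 1" by (simp add: abs_square_le_1)
  define \<zeta> where "\<zeta> = Complex X (sqrt (1 - X^2))"
  have n: "cmod \<zeta> = 1" using X by (simp add: \<zeta>_def cmod_def)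
  define M where "M = cmod (of_real A - of_real (m * t) * \<zeta> - of_real t * \<zeta>^2)"
  have "M^2 = (A + t)^2 + m^2 * t * t - 2 * t * m * (A - t) * X - 4 * t * A * X^2"
    unfolding M_def quadratic_norm_sq n by (simp add: \<zeta>_def)
  then have "4 * \<nu> * ((A + t)^2 * (c^2 + k * t) - c^2 * M^2) = t * (m * (A - t) + 4 * A * X)^2"
    using interior_identity[OF mk, of "c^2" t t X] by (simp add: A_def)
  also have "m * (A - t) + 4 * A * X = 0"
    using A by (simp add: X_def field_simps)
  finally have "(c * M)^2 = (A + t)^2 * (c^2 + k * t)"
    using assms by (simp add: power_mult_distrib)
  also have "\<dots> = (phase_bound k \<nu> (c^2))^2"
    using assms t by (simp add: phase_bound_def power_mult_distrib t_def A_def)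
  finally have sq: "(c * M)^2 = (phase_bound k \<nu> (c^2))^2" .
  have "c * M = phase_bound k \<nu> (c^2)"
  proof (rule power2_eq_imp_eq[OF sq])
    show "0 \<le> c * M" using \<open>0 < c\<close> by (simp add: M_def)
    have "c^2 \<le> 1" using \<open>0 < c\<close> \<open>c \<le> 1\<close> by (simp add: power_le_one)
    then show "0 \<le> phase_bound k \<nu> (c^2)"
      using \<open>0 \<le> k\<close> \<open>0 < \<nu>\<close> by (intro phase_bound_nonneg) simp_all
  qed
  then have "cubic_modulus m \<nu> c \<zeta> = phase_bound k \<nu> (c^2)"
    by (simp add: cubic_modulus_def n M_def A_def t_def)
  with n show ?thesis by (rule that)
qed

lemma cubic_modulus_at_1:
  fixes m \<nu> c :: real
  assumes "0 \<le> c" "0 \<le> real_bound m \<nu> c"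
  shows "cubic_modulus m \<nu> c 1 = real_bound m \<nu> c"
proof -
  have "cubic_modulus m \<nu> c 1 = c * cmod (of_real (\<nu> * c^2 - m * (1 - c^2) - (1 - c^2)))"
    by (simp add: cubic_modulus_def)
  also have "\<dots> = c * \<bar>\<nu> * c^2 - m * (1 - c^2) - (1 - c^2)\<bar>"
    by (simp only: norm_of_real)
  also have "\<nu> * c^2 - m * (1 - c^2) - (1 - c^2) = - ((1 + m) - (1 + m + \<nu>) * c^2)"
    by (simp add: algebra_simps)
  also have "c * \<bar>\<dots>\<bar> = c * \<bar>(1 + m) - (1 + m + \<nu>) * c^2\<bar>"
    by (simp only: abs_minus_cancel)
  also have "\<dots> = real_bound m \<nu> c"
    using assms by (cases "c = 0") (auto simp: real_bound_def zero_le_mult_iff abs_mult)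
  finally show ?thesis .
qed

text \<open>
  Replacing \<open>c\<close>, \<open>\<zeta>\<close>, \<open>\<eta>\<close> by \<open>e c\<close>, \<open>e^2 \<zeta>\<close>, \<open>e^3 \<eta>\<close> with \<open>|e| = 1\<close> multiplies the functional by \<open>e^3\<close>.
  Hence \<open>c\<close> may be taken to be \<open>|c|\<close>, and the triangle inequality removes \<open>\<eta>\<close>.
\<close>
lemma cubic_functional_le:
  fixes m \<nu> :: real and c \<zeta> \<eta> :: complex
  assumes "cmod c \<le> 1" "cmod \<zeta> \<le> 1" "cmod \<eta> \<le> 1"
  defines "t \<equiv> 1 - (cmod c)^2"
  obtains \<zeta>' where "cmod \<zeta>' \<le> 1"
    and "cmod (of_real t * (of_real (1 - (cmod \<zeta>)^2) * \<eta> - cnj c * \<zeta>^2)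
           - of_real m * c * (of_real t * \<zeta>) + of_real \<nu> * c^3) \<le> cubic_modulus m \<nu> (cmod c) \<zeta>'"
proof -
  define r where "r = complex_of_real (cmod c)"
  obtain e where e: "cmod e = 1" "c = r * e"
  proof (cases "c = 0")
    case True
    then show ?thesis by (intro that[of 1]) (auto simp: r_def)
  next
    case False
    then show ?thesis by (intro that[of "c / r"]) (auto simp: r_def norm_divide)
  qed
  have ee: "cnj e * e = 1"
    using e(1) complex_norm_square[of e] by (simp add: mult.commute)
  define \<zeta>' where "\<zeta>' = \<zeta> * cnj e^2"
  have \<zeta>: "\<zeta> = e^2 * \<zeta>'"
    using ee by (simp add: \<zeta>'_def power_mult_distrib[symmetric] mult_ac flip: power_mult_distrib)
  have n: "cmod \<zeta>' = cmod \<zeta>"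
    using e(1) by (simp add: \<zeta>'_def norm_mult norm_power)
  have t: "0 \<le> t"
    using assms by (simp add: t_def power_le_one)
  define Q where "Q = of_real (\<nu> * (cmod c)^2) - of_real (m * t) * \<zeta>' - of_real t * \<zeta>'^2"
  have cc: "cnj c * \<zeta>^2 = r * e^3 * \<zeta>'^2"
  proof -
    have "cnj c * \<zeta>^2 = r * (cnj e * e) * e^3 * \<zeta>'^2"
      unfolding \<zeta> e(2) by (simp add: r_def power2_eq_square power3_eq_cube)
    then show ?thesis by (simp add: ee)
  qed
  have "of_real t * (of_real (1 - (cmod \<zeta>)^2) * \<eta> - cnj c * \<zeta>^2)
           - of_real m * c * (of_real t * \<zeta>) + of_real \<nu> * c^3 =
        of_real (t * (1 - (cmod \<zeta>)^2)) * \<eta> + r * e^3 * Q"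
    unfolding cc Q_def of_real_mult of_real_power r_def[symmetric]
    unfolding \<zeta> e(2) by (simp add: algebra_simps power2_eq_square power3_eq_cube)
  also have "cmod \<dots> \<le> cmod (of_real (t * (1 - (cmod \<zeta>)^2)) * \<eta>) + cmod (r * e^3 * Q)"
    by (rule norm_triangle_ineq)
  also have "cmod (r * e^3 * Q) = cmod c * cmod Q"
    using e(1) by (simp add: norm_mult norm_power r_def)
  also have "cmod (of_real (t * (1 - (cmod \<zeta>)^2)) * \<eta>) = t * (1 - (cmod \<zeta>)^2) * cmod \<eta>"
  proof -
    have "0 \<le> t * (1 - (cmod \<zeta>)^2)"
      using t assms(2) by (simp add: power_le_one)
    then show ?thesis
      unfolding norm_mult norm_of_real by simp
  qed
  also have "t * (1 - (cmod \<zeta>)^2) * cmod \<eta> \<le> t * (1 - (cmod \<zeta>)^2)"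
    using t assms(2,3) by (intro mult_right_le_one_le mult_nonneg_nonneg) (simp_all add: power_le_one)
  finally have "cmod (of_real t * (of_real (1 - (cmod \<zeta>)^2) * \<eta> - cnj c * \<zeta>^2)
           - of_real m * c * (of_real t * \<zeta>) + of_real \<nu> * c^3) \<le> cubic_modulus m \<nu> (cmod c) \<zeta>'"
    by (simp add: cubic_modulus_def n Q_def t_def)
  with n assms(2) show ?thesis
    by (intro that[of \<zeta>']) simp_all
qed


section \<open>From Schur parameters to inverse logarithmic coefficients\<close>

abbreviation mu_coeff :: "real \<Rightarrow> real" where "mu_coeff \<alpha> \<equiv> 7 / 2 * \<alpha>"
abbreviation nu_coeff :: "real \<Rightarrow> real" where "nu_coeff \<alpha> \<equiv> 29 / 12 * \<alpha>^2"

lemma inv_log_coeff_3_le: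
  fixes \<alpha> K :: real
  assumes "0 < \<alpha>" "f \<in> S_ex \<alpha>"
    and K: "\<And>c \<zeta>. 0 \<le> c \<Longrightarrow> c \<le> 1 \<Longrightarrow> cmod \<zeta> \<le> 1 \<Longrightarrow>
              cubic_modulus (mu_coeff \<alpha>) (nu_coeff \<alpha>) c \<zeta> \<le> K"
  shows "cmod (inv_log_coeff f 3) \<le> \<alpha> / 6 * K"
proof -
  obtain \<omega> where \<omega>: "schwarz_function \<omega>"
    "\<And>z. z \<in> unit_disc \<Longrightarrow> z * deriv f z = f z * exp (of_real \<alpha> * \<omega> z)"
    using S_ex_imp_schwarz[OF assms(2)] by blast
  have f: "f \<in> class_A" using assms(2) by (simp add: S_ex_def)
  define C :: "nat \<Rightarrow> complex" where "C = fps_nth (fps_expansion \<omega> 0)"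
  obtain \<zeta> \<eta> where C: "cmod (C 1) \<le> 1" "cmod \<zeta> \<le> 1" "cmod \<eta> \<le> 1"
    "C 2 = of_real (1 - (cmod (C 1))^2) * \<zeta>"
    "C 3 = of_real (1 - (cmod (C 1))^2) * (of_real (1 - (cmod \<zeta>)^2) * \<eta> - cnj (C 1) * \<zeta>^2)"
    using schwarz_coeffs_necessary[OF \<omega>(1)] unfolding C_def by blast
  obtain \<zeta>' where \<zeta>': "cmod \<zeta>' \<le> 1"
    "cmod (C 3 - of_real (mu_coeff \<alpha>) * C 1 * C 2 + of_real (nu_coeff \<alpha>) * (C 1)^3) \<le>
       cubic_modulus (mu_coeff \<alpha>) (nu_coeff \<alpha>) (cmod (C 1)) \<zeta>'"
    using cubic_functional_le[OF C(1,2,3)] unfolding C(4,5) by metis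
  have "inv_log_coeff f 3 = - of_real (\<alpha> / 6) *
      (C 3 - of_real (mu_coeff \<alpha>) * C 1 * C 2 + of_real (nu_coeff \<alpha>) * (C 1)^3)"
    using inv_log_coeff_formulas(3)[OF f \<omega>] by (simp add: C_def)
  then have "cmod (inv_log_coeff f 3) = \<alpha> / 6 *
      cmod (C 3 - of_real (mu_coeff \<alpha>) * C 1 * C 2 + of_real (nu_coeff \<alpha>) * (C 1)^3)"
    using assms(1) by (simp only: norm_mult norm_minus_cancel norm_of_real)
  also have "\<dots> \<le> \<alpha> / 6 * K"
    using \<zeta>'(2) K[OF norm_ge_zero C(1) \<zeta>'(1)] assms(1)
    by (intro mult_left_mono order_trans[OF \<zeta>'(2)]) simp_all
  finally show ?thesis .
qed

lemma S_ex_with_coeffs: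
  assumes "cmod c \<le> 1" "cmod \<zeta> \<le> 1" "cmod \<eta> \<le> 1"
  obtains f where "f \<in> S_ex \<alpha>"
    and "inv_log_coeff f 1 = - (of_real \<alpha> / 2) * c"
    and "inv_log_coeff f 2 = - (of_real \<alpha> / 4) *
           (of_real (1 - (cmod c)^2) * \<zeta> - 3 / 2 * of_real \<alpha> * c^2)"
    and "inv_log_coeff f 3 = - (of_real \<alpha> / 6) *
           (of_real (1 - (cmod c)^2) * (of_real (1 - (cmod \<zeta>)^2) * \<eta> - cnj c * \<zeta>^2)
            - of_real (mu_coeff \<alpha>) * c * (of_real (1 - (cmod c)^2) * \<zeta>)
            + of_real (nu_coeff \<alpha>) * c^3)"
proof -
  obtain \<omega> where \<omega>: "schwarz_function \<omega>" "fps_nth (fps_expansion \<omega> 0) 1 = c"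
    "fps_nth (fps_expansion \<omega> 0) 2 = of_real (1 - (cmod c)^2) * \<zeta>"
    "fps_nth (fps_expansion \<omega> 0) 3 =
       of_real (1 - (cmod c)^2) * (of_real (1 - (cmod \<zeta>)^2) * \<eta> - cnj c * \<zeta>^2)"
    using schwarz_coeffs_sufficient[OF assms] by blast
  obtain f where f: "f \<in> S_ex \<alpha>"
    "\<And>z. z \<in> unit_disc \<Longrightarrow> z * deriv f z = f z * exp (of_real \<alpha> * \<omega> z)"
    using schwarz_imp_S_ex[OF \<omega>(1)] by blast
  have "f \<in> class_A" using f(1) by (simp add: S_ex_def)
  note F = inv_log_coeff_formulas[OF this \<omega>(1) f(2), unfolded \<omega>(2-4)]
  show ?thesis
    by (rule that[OF f(1)]) (use F in simp_all)
qed

lemma inv_log_coeff_3_attained: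
  fixes c \<alpha> :: real
  assumes "0 < \<alpha>" "0 \<le> c" "c \<le> 1" "cmod \<zeta> = 1"
  obtains f where "f \<in> S_ex \<alpha>"
    and "cmod (inv_log_coeff f 3) = \<alpha> / 6 * cubic_modulus (mu_coeff \<alpha>) (nu_coeff \<alpha>) c \<zeta>"
proof -
  define t where "t = 1 - c^2"
  obtain f where f: "f \<in> S_ex \<alpha>"
    "inv_log_coeff f 3 = - (of_real \<alpha> / 6) *
           (of_real (1 - (cmod (of_real c))^2) * (of_real (1 - (cmod \<zeta>)^2) * 0 - cnj (of_real c) * \<zeta>^2)
            - of_real (mu_coeff \<alpha>) * of_real c * (of_real (1 - (cmod (of_real c))^2) * \<zeta>)
            + of_real (nu_coeff \<alpha>) * of_real c^3)"
    by (rule S_ex_with_coeffs[of "of_real c" \<zeta> 0 \<alpha>]) (use assms in auto)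
  have "cmod (of_real c) = c" using assms by simp
  then have "inv_log_coeff f 3 = - of_real (\<alpha> / 6) * (of_real c *
      (of_real (nu_coeff \<alpha> * c^2) - of_real (mu_coeff \<alpha> * t) * \<zeta> - of_real t * \<zeta>^2))"
    unfolding f(2) t_def[symmetric] by (simp add: t_def algebra_simps power2_eq_square power3_eq_cube)
  then have "cmod (inv_log_coeff f 3) = \<alpha> / 6 * (c *
      cmod (of_real (nu_coeff \<alpha> * c^2) - of_real (mu_coeff \<alpha> * t) * \<zeta> - of_real t * \<zeta>^2))"
    using assms by (simp only: norm_mult norm_minus_cancel norm_of_real)
  then show ?thesis
    using that[OF f(1)] assms by (simp add: cubic_modulus_def t_def)
qed


section \<open>The critical parameters\<close>

text \<open>
  The quotient \<open>p x / x = a x^2 + b x - c - d / x\<close> is strictly increasing for positive \<open>x\<close>.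
\<close>
lemma positive_cubic_root:
  fixes a b c d l u :: real
  defines "p \<equiv> \<lambda>x. a * x^3 + b * x^2 - c * x - d"
  assumes "0 < a" "0 < b" "0 < d" "0 < l" "l < u" "p l < 0" "0 < p u"
  obtains r where "l < r" "r < u" "p r = 0" "\<And>x. 0 < x \<Longrightarrow> p x = 0 \<Longrightarrow> x = r"
    "\<And>x. 0 < x \<Longrightarrow> x \<le> r \<longleftrightarrow> p x \<le> 0"
proof -
  have inc: "0 < p y" if "0 < x" "x < y" "0 \<le> p x" for x y
  proof -
    have "x * p y = y * p x + (y - x) * (a * x * y * (x + y) + b * x * y + d)"
      by (simp add: p_def algebra_simps power2_eq_square power3_eq_cube)
    moreover have "0 < (y - x) * (a * x * y * (x + y) + b * x * y + d)"
      using that assms(2-4) by (intro mult_pos_pos add_pos_pos) simp_all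
    moreover have "0 \<le> y * p x" using that by simp
    ultimately have "0 < x * p y" by linarith
    then show ?thesis using that(1) by (simp add: zero_less_mult_iff)
  qed
  have "\<exists>r. l \<le> r \<and> r \<le> u \<and> p r = 0"
    by (rule IVT') (use assms in \<open>auto simp: p_def intro!: continuous_intros\<close>)
  then obtain r where r: "l \<le> r" "r \<le> u" "p r = 0" by blast
  have "l \<noteq> r" "r \<noteq> u" using r(3) assms(7,8) by auto
  then have lr: "l < r" "r < u" using r by auto
  have r0: "0 < r" using lr \<open>0 < l\<close> by simp
  have sign: "x \<le> r \<longleftrightarrow> p x \<le> 0" if "0 < x" for x
    using inc[OF r0, of x] inc[OF that, of r] r(3) that by (smt (verit))
  have "x = r" if "0 < x" "p x = 0" for x
    using inc[OF r0, of x] inc[OF that(1), of r] r(3) that by (smt (verit))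
  then show ?thesis using that lr r(3) sign by blast
qed

lemma alpha_star:
  shows "\<exists>!x. is_alpha_star x" "0.5427115 < alpha_star" "alpha_star < 0.5427125"
    and "0 < x \<Longrightarrow> x \<le> alpha_star \<longleftrightarrow> 686 * x^3 + 327 * x^2 - 210 * x - 92 \<le> 0"
proof -
  obtain r :: real where r: "0.5427115 < r" "r < 0.5427125" "686 * r^3 + 327 * r^2 - 210 * r - 92 = 0"
    "\<And>x. 0 < x \<Longrightarrow> 686 * x^3 + 327 * x^2 - 210 * x - 92 = 0 \<Longrightarrow> x = r"
    "\<And>x. 0 < x \<Longrightarrow> x \<le> r \<longleftrightarrow> 686 * x^3 + 327 * x^2 - 210 * x - 92 \<le> 0"
    by (rule positive_cubic_root[of 686 327 92 "0.5427115" "0.5427125" 210])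
       (simp_all add: power3_eq_cube power2_eq_square)
  have root: "is_alpha_star r" using r(1,3) by (simp add: is_alpha_star_def)
  have un: "x = r" if "is_alpha_star x" for x
    using that r(4) by (simp add: is_alpha_star_def)
  show "\<exists>!x. is_alpha_star x" using root un by blast
  have "alpha_star = r" unfolding alpha_star_def using root un by (rule the_equality)
  then show "0.5427115 < alpha_star" "alpha_star < 0.5427125"
    "0 < x \<Longrightarrow> x \<le> alpha_star \<longleftrightarrow> 686 * x^3 + 327 * x^2 - 210 * x - 92 \<le> 0"
    using r by auto
qed

lemma alpha_b:
  shows "\<exists>!x. is_alpha_b x" "0.6791025 < alpha_b" "alpha_b < 0.6791035"
    and "0 < x \<Longrightarrow> x \<le> alpha_b \<longleftrightarrow> 1421 * x^3 + 812 * x^2 - 712 * x - 336 \<le> 0"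
proof -
  obtain r :: real where r: "0.6791025 < r" "r < 0.6791035" "1421 * r^3 + 812 * r^2 - 712 * r - 336 = 0"
    "\<And>x. 0 < x \<Longrightarrow> 1421 * x^3 + 812 * x^2 - 712 * x - 336 = 0 \<Longrightarrow> x = r"
    "\<And>x. 0 < x \<Longrightarrow> x \<le> r \<longleftrightarrow> 1421 * x^3 + 812 * x^2 - 712 * x - 336 \<le> 0"
    by (rule positive_cubic_root[of 1421 812 336 "0.6791025" "0.6791035" 712])
       (simp_all add: power3_eq_cube power2_eq_square)
  have root: "is_alpha_b r" using r(1,3) by (simp add: is_alpha_b_def)
  have un: "x = r" if "is_alpha_b x" for x
    using that r(4) by (simp add: is_alpha_b_def)
  show "\<exists>!x. is_alpha_b x" using root un by blast
  have "alpha_b = r" unfolding alpha_b_def using root un by (rule the_equality)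
  then show "0.6791025 < alpha_b" "alpha_b < 0.6791035"
    "0 < x \<Longrightarrow> x \<le> alpha_b \<longleftrightarrow> 1421 * x^3 + 812 * x^2 - 712 * x - 336 \<le> 0"
    using r by auto
qed

lemma alpha_c: "0.6910945 < alpha_c" "alpha_c < 0.6910955"
  unfolding alpha_c_def
  by (rule real_less_rsqrt, simp add: power2_eq_square, rule real_less_lsqrt, simp_all add: power2_eq_square)

text \<open>
  The ratio of \<open>m^2\<close> to \<open>4 \<nu>\<close> is the same for all \<open>\<alpha>\<close>.
\<close>
abbreviation k_coeff :: real where "k_coeff \<equiv> 147 / 116"

lemma mu_sq: "(mu_coeff \<alpha>)^2 = 4 * nu_coeff \<alpha> * k_coeff"
  by (simp add: power_mult_distrib power_divide)

lemma threshold_eq: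
  assumes "0 < \<alpha>"
  shows "phase_threshold (mu_coeff \<alpha>) (nu_coeff \<alpha>) = 84 / (203 * \<alpha>^2 + 232 * \<alpha> + 84)"
proof -
  have q: "0 < 203 * \<alpha>^2 + 232 * \<alpha> + 84" using assms by (simp add: add_pos_pos)
  have "4 * nu_coeff \<alpha> + mu_coeff \<alpha> + mu_coeff \<alpha> * nu_coeff \<alpha> =
      \<alpha> / 24 * (203 * \<alpha>^2 + 232 * \<alpha> + 84)"
    by (simp add: field_simps power2_eq_square)
  then have "phase_threshold (mu_coeff \<alpha>) (nu_coeff \<alpha>) =
      mu_coeff \<alpha> / (\<alpha> / 24 * (203 * \<alpha>^2 + 232 * \<alpha> + 84))"
    by (simp only: phase_threshold_def)
  also have "\<dots> = 84 / (203 * \<alpha>^2 + 232 * \<alpha> + 84)"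
    using assms q by (simp add: divide_simps)
  finally show ?thesis .
qed

text \<open>
  The cubic defining \<open>alpha_b\<close> appears here: up to a positive factor it is the derivative, at the phase
  threshold \<open>84 / q\<close>, of the squared phase bound with respect to \<open>s\<close>.
\<close>
lemma alpha_b_factorization:
  fixes \<alpha> :: real
  defines "\<beta> \<equiv> nu_coeff \<alpha> - 1" and "q \<equiv> 203 * \<alpha>^2 + 232 * \<alpha> + 84"
  shows "2 * \<beta> * (147 / 116 * q - 84 * (31 / 116)) - 31 / 116 * (q + 84 * \<beta>) =
    (203 * \<alpha> + 116) * (1421 * \<alpha>^3 + 812 * \<alpha>^2 - 712 * \<alpha> - 336) / 232"
  by (simp add: \<beta>_def q_def field_simps power2_eq_square power3_eq_cube)

section \<open>The four regimes of the third coefficient\<close>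

lemma below_alpha_b_criterion:
  fixes \<alpha> :: real
  assumes "0 < \<alpha>" "\<alpha> \<le> alpha_b"
  defines "\<beta> \<equiv> nu_coeff \<alpha> - 1" and "r \<equiv> phase_threshold (mu_coeff \<alpha>) (nu_coeff \<alpha>)"
  shows "2 * \<beta> * (k_coeff - (k_coeff - 1) * r) \<le> (k_coeff - 1) * (1 + \<beta> * r)"
proof -
  define q where "q = 203 * \<alpha>^2 + 232 * \<alpha> + 84"
  have q: "0 < q" using assms(1) by (simp add: q_def add_pos_pos)
  have r: "r * q = 84"
    using q unfolding r_def threshold_eq[OF assms(1)] q_def[symmetric] by simp
  have "1421 * \<alpha>^3 + 812 * \<alpha>^2 - 712 * \<alpha> - 336 \<le> 0"
    using alpha_b(4)[OF assms(1)] assms(2) by simp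
  then have "(203 * \<alpha> + 116) * (1421 * \<alpha>^3 + 812 * \<alpha>^2 - 712 * \<alpha> - 336) / 232 \<le> 0"
    using assms(1) by (intro divide_nonpos_pos mult_nonneg_nonpos) simp_all
  then have "2 * \<beta> * (147 / 116 * q - 84 * (31 / 116)) - 31 / 116 * (q + 84 * \<beta>) \<le> 0"
    unfolding \<beta>_def q_def alpha_b_factorization .
  then have "q * (2 * \<beta> * (k_coeff - (k_coeff - 1) * r) - (k_coeff - 1) * (1 + \<beta> * r)) \<le> 0"
    unfolding r[symmetric] by (simp add: field_simps)
  then show ?thesis
    using q by (simp add: mult_le_0_iff)
qed

lemma cubic_modulus_le_below_alpha_b:
  fixes \<alpha> K c :: real
  assumes "0 < \<alpha>" "\<alpha> \<le> alpha_b" "0 \<le> c" "c \<le> 1" "cmod \<zeta> \<le> 1" "1 \<le> K"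
    and "2 / 3 * (1 + mu_coeff \<alpha>) *
      sqrt ((1 + mu_coeff \<alpha>) / (3 * (1 + mu_coeff \<alpha> + nu_coeff \<alpha>))) \<le> K"
  shows "cubic_modulus (mu_coeff \<alpha>) (nu_coeff \<alpha>) c \<zeta> \<le> K"
proof (rule cubic_modulus_le[OF mu_sq _ _ _ _ assms(3,4,5,6)])
  show "0 < mu_coeff \<alpha>" "0 < nu_coeff \<alpha>" "mu_coeff \<alpha> \<le> 4" "1 \<le> k_coeff"
    using assms(1,2) alpha_b(3) by simp_all
  show "real_bound (mu_coeff \<alpha>) (nu_coeff \<alpha>) c \<le> K" if "0 \<le> c" "c \<le> 1" for c
    using real_bound_le[of "mu_coeff \<alpha>" "nu_coeff \<alpha>" c] that(1) assms(1,7) by simp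
  show "2 * (nu_coeff \<alpha> - 1) *
      (k_coeff - (k_coeff - 1) * phase_threshold (mu_coeff \<alpha>) (nu_coeff \<alpha>))
      \<le> (k_coeff - 1) * (1 + (nu_coeff \<alpha> - 1) * phase_threshold (mu_coeff \<alpha>) (nu_coeff \<alpha>))"
    by (rule below_alpha_b_criterion[OF assms(1,2)])
qed

lemma real_max_eq:
  fixes \<alpha> :: real
  assumes "0 < \<alpha>"
  shows "(1 + mu_coeff \<alpha>) / (3 * (1 + mu_coeff \<alpha> + nu_coeff \<alpha>)) =
    2 * (7 * \<alpha> + 2) / (29 * \<alpha>^2 + 42 * \<alpha> + 12)"
proof -
  have "0 < 1 + mu_coeff \<alpha> + nu_coeff \<alpha>" "0 < 29 * \<alpha>^2 + 42 * \<alpha> + 12"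
    using assms by (simp_all add: add_pos_pos)
  then show ?thesis
    by (simp add: frac_eq_eq) (simp add: field_simps power2_eq_square)
qed

text \<open>
  Squaring turns \<open>K \<le> 1\<close> into the cubic inequality that defines \<open>alpha_star\<close>.
\<close>
lemma real_max_vs_1:
  fixes \<alpha> :: real
  assumes "0 < \<alpha>"
  defines "K \<equiv> 2 / 3 * (1 + mu_coeff \<alpha>) *
      sqrt ((1 + mu_coeff \<alpha>) / (3 * (1 + mu_coeff \<alpha> + nu_coeff \<alpha>)))"
  shows "K \<le> 1 \<longleftrightarrow> \<alpha> \<le> alpha_star"
proof -
  define D where "D = 29 * \<alpha>^2 + 42 * \<alpha> + 12"
  have D: "0 < D" using assms(1) by (simp add: D_def add_pos_pos)
  have K0: "0 \<le> K" using assms(1) by (simp add: K_def)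
  have "0 \<le> 2 * (7 * \<alpha> + 2) / D" using D assms(1) by simp
  then have "K^2 = (2 / 3 * (1 + mu_coeff \<alpha>))^2 * (2 * (7 * \<alpha> + 2) / D)"
    unfolding K_def real_max_eq[OF assms(1)] D_def[symmetric]
    by (simp only: power_mult_distrib real_sqrt_pow2)
  also have "\<dots> = 2 * (7 * \<alpha> + 2)^3 / (9 * D)"
    using D by (simp add: field_simps power2_eq_square power3_eq_cube)
  finally have K2: "K^2 = 2 * (7 * \<alpha> + 2)^3 / (9 * D)" .
  have "K \<le> 1 \<longleftrightarrow> K^2 \<le> 1"
    using K0 by (simp add: abs_square_le_1)
  also have "\<dots> \<longleftrightarrow> 2 * (7 * \<alpha> + 2)^3 \<le> 9 * D"
    unfolding K2 using D by (simp add: divide_le_eq)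
  also have "\<dots> \<longleftrightarrow> 686 * \<alpha>^3 + 327 * \<alpha>^2 - 210 * \<alpha> - 92 \<le> 0"
    by (simp add: D_def algebra_simps power2_eq_square power3_eq_cube)
  also have "\<dots> \<longleftrightarrow> \<alpha> \<le> alpha_star"
    using alpha_star(4)[OF assms(1)] by simp
  finally show ?thesis .
qed

lemma real_max_attained:
  fixes \<alpha> :: real
  assumes "0 < \<alpha>"
  obtains f where "f \<in> S_ex \<alpha>" and "cmod (inv_log_coeff f 3) = \<alpha> / 6 * (2 / 3 * (1 + mu_coeff \<alpha>) *
      sqrt ((1 + mu_coeff \<alpha>) / (3 * (1 + mu_coeff \<alpha> + nu_coeff \<alpha>))))"
proof -
  define m \<nu> where "m = mu_coeff \<alpha>" and "\<nu> = nu_coeff \<alpha>"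
  have pos: "0 < m" "0 < \<nu>" using assms by (simp_all add: m_def \<nu>_def)
  define c where "c = sqrt ((1 + m) / (3 * (1 + m + \<nu>)))"
  have c: "0 \<le> c" "c \<le> 1" using pos by (simp_all add: c_def divide_le_eq_1)
  have rb: "real_bound m \<nu> c = 2 / 3 * (1 + m) * c"
    unfolding c_def by (rule real_bound_at_max[OF pos])
  moreover have "0 \<le> 2 / 3 * (1 + m) * c"
    using c pos by simp
  ultimately have "cubic_modulus m \<nu> c 1 = 2 / 3 * (1 + m) * c"
    using cubic_modulus_at_1[OF c(1), of m \<nu>] by simp
  then show ?thesis
    using inv_log_coeff_3_attained[OF assms c, of 1] that unfolding c_def m_def \<nu>_def by (metis norm_one)
qed

lemma phase_max_eq:
  fixes \<alpha> :: real
  assumes "1 < nu_coeff \<alpha>" "0 < 49 * \<alpha>^2 - 16"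
  defines "K \<equiv> 29 * (49 * \<alpha>^2 - 16) powr (3 / 2) / (372 * sqrt (29 * \<alpha>^2 - 12))"
  shows "4 * (k_coeff * nu_coeff \<alpha> - 1)^3 / (27 * (k_coeff - 1)^2 * (nu_coeff \<alpha> - 1)) = K^2"
proof -
  define y w where "y = 49 * \<alpha>^2 - 16" and "w = 29 * \<alpha>^2 - 12"
  have w: "0 < w" using assms(1) by (simp add: w_def)
  have e: "k_coeff * nu_coeff \<alpha> - 1 = y / 16" "nu_coeff \<alpha> - 1 = w / 12"
    by (simp_all add: y_def w_def)
  have "(y powr (3 / 2))^2 = y powr 3"
    by (simp add: power2_eq_square powr_add[symmetric])
  also have "\<dots> = y^3"
    using assms(2) by (simp add: y_def)
  finally have "K^2 = 841 * y^3 / (138384 * w)"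
    using w unfolding K_def y_def[symmetric] w_def[symmetric]
    by (simp add: power_divide power_mult_distrib)
  also have "\<dots> = 4 * (y / 16)^3 / (27 * (k_coeff - 1)^2 * (w / 12))"
    using w by (simp add: power_divide)
  finally show ?thesis
    unfolding e by simp
qed

lemma phase_max_le:
  fixes \<alpha> c :: real
  assumes "0 < \<alpha>" "1 < nu_coeff \<alpha>" "0 < 49 * \<alpha>^2 - 16" "0 \<le> c" "c \<le> 1" "cmod \<zeta> \<le> 1"
  shows "cubic_modulus (mu_coeff \<alpha>) (nu_coeff \<alpha>) c \<zeta> \<le>
    29 * (49 * \<alpha>^2 - 16) powr (3 / 2) / (372 * sqrt (29 * \<alpha>^2 - 12))"
proof -
  have "cubic_modulus (mu_coeff \<alpha>) (nu_coeff \<alpha>) c \<zeta> \<le> phase_bound k_coeff (nu_coeff \<alpha>) (c^2)"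
    by (rule cubic_modulus_le_phase_bound[OF mu_sq]) (use assms in simp_all)
  also have "\<dots> \<le> 29 * (49 * \<alpha>^2 - 16) powr (3 / 2) / (372 * sqrt (29 * \<alpha>^2 - 12))"
  proof (rule power2_le_imp_le)
    show "(phase_bound k_coeff (nu_coeff \<alpha>) (c^2))^2 \<le>
        (29 * (49 * \<alpha>^2 - 16) powr (3 / 2) / (372 * sqrt (29 * \<alpha>^2 - 12)))^2"
      unfolding phase_max_eq[OF assms(2,3), symmetric]
      by (rule phase_bound_sq_le) (use assms(2,4,5) in \<open>simp_all add: power_le_one\<close>)
    show "0 \<le> 29 * (49 * \<alpha>^2 - 16) powr (3 / 2) / (372 * sqrt (29 * \<alpha>^2 - 12))"
      using assms(2) by simp
  qed
  finally show ?thesis .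
qed

text \<open>
  Beyond \<open>alpha_b\<close> the maximiser \<open>s\<close> of the phase bound lies above the phase threshold, and the last
  hypothesis is equivalent to \<open>s \<le> 1\<close>.  So a unimodular \<open>\<zeta>\<close> with the stationary real part exists at \<open>c = sqrt s\<close>.
\<close>
lemma phase_max_attained:
  fixes \<alpha> :: real
  assumes "0 < \<alpha>" "\<alpha> \<le> 1" "alpha_b < \<alpha>" "1 < nu_coeff \<alpha>" "0 < 49 * \<alpha>^2 - 16" "nu_coeff \<alpha> \<le> 232 / 201"
  obtains f where "f \<in> S_ex \<alpha>" and "cmod (inv_log_coeff f 3) = \<alpha> / 6 *
    (29 * (49 * \<alpha>^2 - 16) powr (3 / 2) / (372 * sqrt (29 * \<alpha>^2 - 12)))"
proof -
  define K where "K = 29 * (49 * \<alpha>^2 - 16) powr (3 / 2) / (372 * sqrt (29 * \<alpha>^2 - 12))"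
  define m \<nu> where "m = mu_coeff \<alpha>" and "\<nu> = nu_coeff \<alpha>"
  define \<beta> where "\<beta> = \<nu> - 1"
  define s where "s = (2 * (\<nu> - 1) * k_coeff - (k_coeff - 1)) / (3 * (\<nu> - 1) * (k_coeff - 1))"
  define q where "q = 203 * \<alpha>^2 + 232 * \<alpha> + 84"
  have q: "0 < q" using assms(1) by (simp add: q_def add_pos_pos)
  have \<beta>: "0 < \<beta>" using assms(4) by (simp add: \<beta>_def \<nu>_def)
  have s\<beta>: "s * (93 * \<beta>) = 294 * \<beta> - 31"
    using \<beta> unfolding s_def \<beta>_def[symmetric] by (simp add: field_simps)
  have "\<not> 1421 * \<alpha>^3 + 812 * \<alpha>^2 - 712 * \<alpha> - 336 \<le> 0"
    using alpha_b(4)[OF assms(1)] assms(3) by simp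
  then have "0 \<le> (203 * \<alpha> + 116) * (1421 * \<alpha>^3 + 812 * \<alpha>^2 - 712 * \<alpha> - 336) / 232"
    using assms(1) by (intro divide_nonneg_pos mult_nonneg_nonneg) simp_all
  then have "0 \<le> 2 * \<beta> * (147 / 116 * q - 84 * (31 / 116)) - 31 / 116 * (q + 84 * \<beta>)"
    unfolding \<beta>_def \<nu>_def q_def alpha_b_factorization .
  also have "\<dots> = (s * (93 * \<beta>) * q - 84 * (93 * \<beta>)) / 116"
    unfolding s\<beta> by (simp add: field_simps)
  finally have "0 \<le> (93 * \<beta>) * (s * q - 84)"
    by (simp add: algebra_simps)
  then have sq: "84 \<le> s * q"
    using \<beta> by (simp add: zero_le_mult_iff)
  then have "0 < s * q" by linarith
  then have s0: "0 < s"
    using q by (simp add: zero_less_mult_iff)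
  have s1: "s \<le> 1"
  proof -
    have "s * (93 * \<beta>) \<le> 1 * (93 * \<beta>)"
      unfolding s\<beta> using assms(6) by (simp add: \<beta>_def \<nu>_def)
    then show ?thesis
      using \<beta> by (simp only: mult_le_cancel_right)
  qed
  have "4 * \<nu> + m + m * \<nu> = \<alpha> / 24 * q"
    by (simp add: m_def \<nu>_def q_def field_simps power2_eq_square)
  then have "s * (4 * \<nu> + m + m * \<nu>) = \<alpha> / 24 * (s * q)" by simp
  also have "\<dots> \<ge> \<alpha> / 24 * 84"
    using sq assms(1) by (intro mult_left_mono) simp_all
  also have "\<alpha> / 24 * 84 = m" by (simp add: m_def)
  finally have above: "m * (1 - s - \<nu> * s) \<le> 4 * \<nu> * s"
    by (simp add: algebra_simps)
  have sqrt_s: "(sqrt s)^2 = s" "0 < sqrt s" "sqrt s \<le> 1" using s0 s1 by simp_all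
  obtain \<zeta> where \<zeta>: "cmod \<zeta> = 1" "cubic_modulus m \<nu> (sqrt s) \<zeta> = phase_bound k_coeff \<nu> ((sqrt s)^2)"
  proof (rule cubic_modulus_attains_phase_bound[of m \<nu> k_coeff "sqrt s"])
    show "m^2 = 4 * \<nu> * k_coeff" unfolding m_def \<nu>_def by (rule mu_sq)
    show "m * (1 - (sqrt s)^2 - \<nu> * (sqrt s)^2) \<le> 4 * \<nu> * (sqrt s)^2"
      unfolding sqrt_s(1) by (rule above)
  qed (use assms sqrt_s in \<open>simp_all add: m_def \<nu>_def\<close>)
  have "(phase_bound k_coeff \<nu> s)^2 = K^2"
    unfolding K_def phase_max_eq[OF assms(4,5), symmetric] \<nu>_def[symmetric]
    by (rule phase_bound_sq_at_max[of k_coeff \<nu>, folded s_def])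
       (use assms(4) s0 s1 in \<open>simp_all add: \<nu>_def\<close>)
  moreover have "0 \<le> phase_bound k_coeff \<nu> s"
    using s0 s1 assms(1) by (intro phase_bound_nonneg) (simp_all add: \<nu>_def)
  moreover have "0 \<le> K" using assms(4) by (simp add: K_def)
  ultimately have "phase_bound k_coeff \<nu> s = K"
    by (rule power2_eq_imp_eq)
  then have "cubic_modulus m \<nu> (sqrt s) \<zeta> = K"
    using \<zeta>(2) by (simp add: sqrt_s)
  then show ?thesis
    using inv_log_coeff_3_attained[OF assms(1) _ sqrt_s(3) \<zeta>(1)] sqrt_s(2) that
    unfolding m_def \<nu>_def K_def by (metis less_imp_le)
qed

lemma inv_log_coeff_3_attained_1:
  assumes "0 < \<alpha>"
  obtains f where "f \<in> S_ex \<alpha>" "cmod (inv_log_coeff f 3) = \<alpha> / 6"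
proof -
  obtain f where f: "f \<in> S_ex \<alpha>" "inv_log_coeff f 3 = - (of_real \<alpha> / 6)"
    by (rule S_ex_with_coeffs[of 0 0 1 \<alpha>]) auto
  show ?thesis
    by (rule that[OF f(1)]) (use f(2) assms in \<open>simp add: norm_divide\<close>)
qed

lemma inv_log_coeff_3_attained_nu:
  assumes "0 < \<alpha>"
  obtains f where "f \<in> S_ex \<alpha>" "cmod (inv_log_coeff f 3) = \<alpha> / 6 * nu_coeff \<alpha>"
proof -
  obtain f where f: "f \<in> S_ex \<alpha>" "inv_log_coeff f 3 = - of_real (\<alpha> / 6 * nu_coeff \<alpha>)"
    by (rule S_ex_with_coeffs[of 1 0 0 \<alpha>]) auto
  have "cmod (inv_log_coeff f 3) = \<alpha> / 6 * nu_coeff \<alpha>"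
    unfolding f(2) norm_minus_cancel norm_of_real using assms by simp
  with f(1) show ?thesis by (rule that)
qed

text \<open>
  In each regime the constant \<open>K\<close> is the exact maximum of \<open>cubic_modulus\<close>.  The extremal Schwarz functions
  are \<open>z^3\<close>, then \<open>z (z + c) / (1 + c z)\<close>, then \<open>z (\<zeta> z + c) / (1 + c \<zeta> z)\<close> with nonreal \<open>\<zeta>\<close>, and finally \<open>z\<close>.
\<close>
lemma third_coeff_sharp:
  fixes \<alpha> :: real
  assumes "0 < \<alpha>" "\<alpha> \<le> 1"
  shows "\<exists>K. bound3 \<alpha> = \<alpha> / 6 * K \<and>
     (\<forall>c \<zeta>. 0 \<le> c \<longrightarrow> c \<le> 1 \<longrightarrow> cmod \<zeta> \<le> 1 \<longrightarrow>
        cubic_modulus (mu_coeff \<alpha>) (nu_coeff \<alpha>) c \<zeta> \<le> K) \<and>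
     (\<exists>f\<in>S_ex \<alpha>. cmod (inv_log_coeff f 3) = \<alpha> / 6 * K)"
proof -
  define K2 where "K2 = 2 / 3 * (1 + mu_coeff \<alpha>) *
      sqrt ((1 + mu_coeff \<alpha>) / (3 * (1 + mu_coeff \<alpha> + nu_coeff \<alpha>)))"
  define K3 where "K3 = 29 * (49 * \<alpha>^2 - 16) powr (3 / 2) / (372 * sqrt (29 * \<alpha>^2 - 12))"
  have K2_iff: "K2 \<le> 1 \<longleftrightarrow> \<alpha> \<le> alpha_star"
    unfolding K2_def by (rule real_max_vs_1[OF assms(1)])
  have lt: "alpha_star < alpha_b" using alpha_star(3) alpha_b(2) by simp
  consider (I) "\<alpha> \<le> alpha_star" | (II) "alpha_star < \<alpha>" "\<alpha> \<le> alpha_b"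
    | (III) "alpha_b < \<alpha>" "\<alpha> < alpha_c" | (IV) "alpha_b < \<alpha>" "alpha_c \<le> \<alpha>"
    by linarith
  then show ?thesis
  proof cases
    case I
    have "cubic_modulus (mu_coeff \<alpha>) (nu_coeff \<alpha>) c \<zeta> \<le> 1"
      if "0 \<le> c" "c \<le> 1" "cmod \<zeta> \<le> 1" for c \<zeta>
      using I lt K2_iff
      by (intro cubic_modulus_le_below_alpha_b[OF assms(1) _ that]) (simp_all add: K2_def)
    moreover have "bound3 \<alpha> = \<alpha> / 6 * 1" using I by (simp add: bound3_def)
    ultimately show ?thesis
      using inv_log_coeff_3_attained_1[OF assms(1)] by (intro exI[of _ 1]) (metis mult.right_neutral)
  next
    case II
    have "cubic_modulus (mu_coeff \<alpha>) (nu_coeff \<alpha>) c \<zeta> \<le> K2"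
      if "0 \<le> c" "c \<le> 1" "cmod \<zeta> \<le> 1" for c \<zeta>
      using II K2_iff
      by (intro cubic_modulus_le_below_alpha_b[OF assms(1) _ that]) (simp_all add: K2_def)
    moreover have "bound3 \<alpha> = \<alpha> / 6 * K2"
      using II unfolding K2_def real_max_eq[OF assms(1)] by (simp add: bound3_def field_simps)
    moreover have "\<exists>f\<in>S_ex \<alpha>. cmod (inv_log_coeff f 3) = \<alpha> / 6 * K2"
      using real_max_attained[OF assms(1)] unfolding K2_def by blast
    ultimately show ?thesis by blast
  next
    case III
    have a2: "0.6791025^2 < \<alpha>^2"
      using III(1) alpha_b(2) by (intro power_strict_mono) simp_all
    have "\<alpha>^2 < alpha_c^2" using III(2) assms(1) by (intro power_strict_mono) simp_all
    then have ac: "nu_coeff \<alpha> \<le> 232 / 201" by (simp add: alpha_c_def)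
    have pos: "1 < nu_coeff \<alpha>" "0 < 49 * \<alpha>^2 - 16"
      using a2 by (simp_all add: power2_eq_square)
    have "cubic_modulus (mu_coeff \<alpha>) (nu_coeff \<alpha>) c \<zeta> \<le> K3"
      if "0 \<le> c" "c \<le> 1" "cmod \<zeta> \<le> 1" for c \<zeta>
      unfolding K3_def by (rule phase_max_le[OF assms(1) pos that])
    moreover have "bound3 \<alpha> = \<alpha> / 6 * K3"
      using III lt by (simp add: bound3_def K3_def)
    moreover have "\<exists>f\<in>S_ex \<alpha>. cmod (inv_log_coeff f 3) = \<alpha> / 6 * K3"
      using phase_max_attained[OF assms III(1) pos ac] unfolding K3_def by blast
    ultimately show ?thesis by blast
  next
    case IV
    have "0 \<le> alpha_c" by (simp add: alpha_c_def)
    then have "alpha_c^2 \<le> \<alpha>^2" using IV(2) by (intro power_mono)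
    then have ac: "232 / 201 \<le> nu_coeff \<alpha>" by (simp add: alpha_c_def)
    have "cubic_modulus (mu_coeff \<alpha>) (nu_coeff \<alpha>) c \<zeta> \<le> nu_coeff \<alpha>"
      if "0 \<le> c" "c \<le> 1" "cmod \<zeta> \<le> 1" for c \<zeta>
    proof -
      have "cubic_modulus (mu_coeff \<alpha>) (nu_coeff \<alpha>) c \<zeta> \<le> phase_bound k_coeff (nu_coeff \<alpha>) (c^2)"
        by (rule cubic_modulus_le_phase_bound[OF mu_sq]) (use assms that in simp_all)
      also have "\<dots> \<le> nu_coeff \<alpha>"
        by (rule phase_bound_le_endpoint) (use ac that in \<open>simp_all add: power_le_one\<close>)
      finally show ?thesis .
    qed
    moreover have "bound3 \<alpha> = \<alpha> / 6 * nu_coeff \<alpha>"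
      using IV lt by (simp add: bound3_def power2_eq_square power3_eq_cube)
    moreover have "\<exists>f\<in>S_ex \<alpha>. cmod (inv_log_coeff f 3) = \<alpha> / 6 * nu_coeff \<alpha>"
      using inv_log_coeff_3_attained_nu[OF assms(1)] by blast
    ultimately show ?thesis by blast
  qed
qed


section \<open>Sharp bounds for all three coefficients\<close>

lemma inv_log_coeff_1_le:
  assumes "0 < \<alpha>" "f \<in> S_ex \<alpha>"
  shows "cmod (inv_log_coeff f 1) \<le> \<alpha> / 2"
proof -
  obtain \<omega> where \<omega>: "schwarz_function \<omega>"
    "\<And>z. z \<in> unit_disc \<Longrightarrow> z * deriv f z = f z * exp (of_real \<alpha> * \<omega> z)"
    using S_ex_imp_schwarz[OF assms(2)] by blast
  have f: "f \<in> class_A" using assms(2) by (simp add: S_ex_def)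
  have "cmod (fps_nth (fps_expansion \<omega> 0) 1) \<le> 1"
    using schwarz_coeffs_necessary[OF \<omega>(1)] by blast
  then have "\<alpha> / 2 * cmod (fps_nth (fps_expansion \<omega> 0) 1) \<le> \<alpha> / 2 * 1"
    using assms(1) by (intro mult_left_mono) simp_all
  moreover have "inv_log_coeff f 1 = - (of_real \<alpha> / 2) * fps_nth (fps_expansion \<omega> 0) 1"
    by (rule inv_log_coeff_formulas(1)[OF f \<omega>])
  ultimately show ?thesis
    using assms(1) by (simp add: norm_mult norm_divide)
qed

lemma inv_log_coeff_2_le:
  assumes "0 < \<alpha>" "f \<in> S_ex \<alpha>"
  shows "cmod (inv_log_coeff f 2) \<le> \<alpha> / 4 * max 1 (3 / 2 * \<alpha>)"
proof -
  obtain \<omega> where \<omega>: "schwarz_function \<omega>"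
    "\<And>z. z \<in> unit_disc \<Longrightarrow> z * deriv f z = f z * exp (of_real \<alpha> * \<omega> z)"
    using S_ex_imp_schwarz[OF assms(2)] by blast
  have f: "f \<in> class_A" using assms(2) by (simp add: S_ex_def)
  define C :: "nat \<Rightarrow> complex" where "C = fps_nth (fps_expansion \<omega> 0)"
  obtain \<zeta> where C: "cmod (C 1) \<le> 1" "cmod \<zeta> \<le> 1" "C 2 = of_real (1 - (cmod (C 1))^2) * \<zeta>"
    using schwarz_coeffs_necessary[OF \<omega>(1)] unfolding C_def by blast
  define s where "s = (cmod (C 1))^2"
  have s: "0 \<le> s" "s \<le> 1" using C(1) by (simp_all add: s_def power_le_one)
  have "cmod (C 2 - 3 / 2 * of_real \<alpha> * (C 1)^2) \<le> cmod (C 2) + cmod (3 / 2 * of_real \<alpha> * (C 1)^2)"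
    by (rule norm_triangle_ineq4)
  also have "cmod (3 / 2 * of_real \<alpha> * (C 1)^2) = 3 / 2 * \<alpha> * s"
    using assms(1) by (simp add: norm_mult norm_power s_def)
  also have "cmod (C 2) = (1 - s) * cmod \<zeta>"
    using s unfolding C(3) s_def[symmetric] norm_mult norm_of_real by simp
  also have "(1 - s) * cmod \<zeta> + 3 / 2 * \<alpha> * s \<le> (1 - s) * max 1 (3 / 2 * \<alpha>) + max 1 (3 / 2 * \<alpha>) * s"
    using s C(2) assms(1) by (intro add_mono mult_mono) simp_all
  also have "\<dots> = max 1 (3 / 2 * \<alpha>)" by (simp add: algebra_simps)
  finally have "\<alpha> / 4 * cmod (C 2 - 3 / 2 * of_real \<alpha> * (C 1)^2) \<le> \<alpha> / 4 * max 1 (3 / 2 * \<alpha>)"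
    using assms(1) by (intro mult_left_mono) simp_all
  moreover have "inv_log_coeff f 2 = - (of_real \<alpha> / 4) * (C 2 - 3 / 2 * of_real \<alpha> * (C 1)^2)"
    unfolding C_def by (rule inv_log_coeff_formulas(2)[OF f \<omega>])
  then have "inv_log_coeff f 2 = - of_real (\<alpha> / 4) * (C 2 - 3 / 2 * of_real \<alpha> * (C 1)^2)"
    by simp
  then have "cmod (inv_log_coeff f 2) = \<alpha> / 4 * cmod (C 2 - 3 / 2 * of_real \<alpha> * (C 1)^2)"
    using assms(1) by (simp only: norm_mult norm_minus_cancel norm_of_real)
  ultimately show ?thesis by simp
qed

lemma bound2_eq: "0 < \<alpha> \<Longrightarrow> bound2 \<alpha> = \<alpha> / 4 * max 1 (3 / 2 * \<alpha>)"
  by (simp add: bound2_def max_def power2_eq_square)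

lemma inv_log_coeff_1_attained:
  assumes "0 < \<alpha>"
  shows "\<exists>f\<in>S_ex \<alpha>. cmod (inv_log_coeff f 1) = \<alpha> / 2"
proof -
  obtain f where "f \<in> S_ex \<alpha>" "inv_log_coeff f 1 = - (of_real \<alpha> / 2) * 1"
    using S_ex_with_coeffs[of 1 0 0 \<alpha>] by auto
  with assms show ?thesis by (intro bexI[of _ f]) (simp_all add: norm_divide)
qed

lemma inv_log_coeff_2_attained:
  assumes "0 < \<alpha>"
  shows "\<exists>f\<in>S_ex \<alpha>. cmod (inv_log_coeff f 2) = \<alpha> / 4 * max 1 (3 / 2 * \<alpha>)"
proof (cases "3 / 2 * \<alpha> \<le> 1")
  case True
  obtain f where "f \<in> S_ex \<alpha>" "inv_log_coeff f 2 = - (of_real \<alpha> / 4)"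
    by (rule S_ex_with_coeffs[of 0 1 0 \<alpha>]) auto
  with assms True show ?thesis by (intro bexI[of _ f]) (simp_all add: norm_divide)
next
  case False
  obtain f where f: "f \<in> S_ex \<alpha>" "inv_log_coeff f 2 = of_real (\<alpha> / 4 * (3 / 2 * \<alpha>))"
    by (rule S_ex_with_coeffs[of 1 0 0 \<alpha>]) auto
  have "cmod (inv_log_coeff f 2) = \<alpha> / 4 * (3 / 2 * \<alpha>)"
    unfolding f(2) norm_of_real using assms by simp
  with f(1) False show ?thesis by (intro bexI[of _ f]) simp_all
qed

theorem theorem3p1:
  fixes \<alpha> :: real
  assumes "0 < \<alpha>" and "\<alpha> \<le> 1"
  shows "(\<exists>!x. is_alpha_star x) \<and> \<bar>alpha_star - 0.542712\<bar> < 0.0000005 \<and>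
    (\<exists>!x. is_alpha_b x) \<and> \<bar>alpha_b - 0.679103\<bar> < 0.0000005 \<and>
    \<bar>alpha_c - 0.691095\<bar> < 0.0000005 \<and>
    (\<forall>f\<in>S_ex \<alpha>. cmod (inv_log_coeff f 1) \<le> bound1 \<alpha> \<and>
                cmod (inv_log_coeff f 2) \<le> bound2 \<alpha> \<and>
                cmod (inv_log_coeff f 3) \<le> bound3 \<alpha>) \<and>
    (\<exists>f\<in>S_ex \<alpha>. cmod (inv_log_coeff f 1) = bound1 \<alpha>) \<and>
    (\<exists>f\<in>S_ex \<alpha>. cmod (inv_log_coeff f 2) = bound2 \<alpha>) \<and>
    (\<exists>f\<in>S_ex \<alpha>. cmod (inv_log_coeff f 3) = bound3 \<alpha>)"
proof -
  obtain K where K: "bound3 \<alpha> = \<alpha> / 6 * K"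
    "\<And>c \<zeta>. 0 \<le> c \<Longrightarrow> c \<le> 1 \<Longrightarrow> cmod \<zeta> \<le> 1 \<Longrightarrow>
       cubic_modulus (mu_coeff \<alpha>) (nu_coeff \<alpha>) c \<zeta> \<le> K"
    "\<exists>f\<in>S_ex \<alpha>. cmod (inv_log_coeff f 3) = \<alpha> / 6 * K"
    using third_coeff_sharp[OF assms] by blast
  have "cmod (inv_log_coeff f 3) \<le> \<alpha> / 6 * K" if "f \<in> S_ex \<alpha>" for f
    using inv_log_coeff_3_le[OF assms(1) that K(2)] .
  moreover have "\<bar>alpha_star - 0.542712\<bar> < 0.0000005" "\<bar>alpha_b - 0.679103\<bar> < 0.0000005"
    "\<bar>alpha_c - 0.691095\<bar> < 0.0000005"
    using alpha_star(2,3) alpha_b(2,3) alpha_c unfolding abs_less_iff by simp_all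
  ultimately show ?thesis
    unfolding bound1_def bound2_eq[OF assms(1)] K(1)
    using alpha_star(1) alpha_b(1) K(3)
      inv_log_coeff_1_le[OF assms(1)] inv_log_coeff_1_attained[OF assms(1)]
      inv_log_coeff_2_le[OF assms(1)] inv_log_coeff_2_attained[OF assms(1)]
    by blast
qed

end
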